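(* Let $\lambda>0$ and $R>0$ be real numbers, and let $t_0:=\frac{\pi}{2\lambda}$. Then there exists a $t_0$-periodic function $\delta:[0,+\infty)\to[0,+\infty)$ such that every solution $u:[0,+\infty)\to\mathbb{R}$ to $$u''(t)+2\delta(t)u'(t)+\lambda^2u(t)=0$$ satisfies $$|u'(t)|^2+\lambda^2|u(t)|^2\le\left(|u'(0)|^2+\lambda^2|u(0)|^2\right)\exp\left(-R\,(t-t_0)^+\right)\qquad\forall t\ge 0.$$ Moreover, $\delta$ can be chosen of class $C^\infty$, and it can alternatively be chosen piecewise constant (i.e. there exist both a $C^\infty$ function $\delta:[0,+\infty)\to[0,+\infty)$ and a piecewise constant function $\delta:[0,+\infty)\to[0,+\infty)$, each of which is $t_0$-periodic and such that every solution $u$ to $u''(t)+2\delta(t)u'(t)+\lambda^2u(t)=0$ satisfies $|u'(t)|^2+\lambda^2|u(t)|^2\le\left(|u'(0)|^2+\lambda^2|u(0)|^2\right)\exp\left(-R\,(t-t_0)^+\right)$ for every $t\ge 0$).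
   Context: $(x)^+:=\max\{x,0\}$. Piecewise constant means having finitely many constancy intervals on each bounded interval. When $\delta$ is not continuous, a solution is a function $u\in C^1([0,+\infty))$ with $u'$ locally absolutely continuous that satisfies the equation for almost every $t$. *)

theory Defs
  imports "HOL-Analysis.Analysis"
begin

text \<open>
  A function on the half-line \<open>[0,\<infinity>)\<close> is represented by a total function on the reals, and only its
  values on \<^term>\<open>{0::real..}\<close> are ever used: derivatives are taken within \<^term>\<open>{0::real..}\<close>,
  hence they are one-sided at \<open>0\<close>.
\<close>

definition periodic_on_halfline :: "real \<Rightarrow> (real \<Rightarrow> real) \<Rightarrow> bool" where
  "periodic_on_halfline p f \<longleftrightarrow> (\<forall>t\<ge>0. f (t + p) = f t)"

definition smooth_on_halfline :: "(real \<Rightarrow> real) \<Rightarrow> bool" where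
  "smooth_on_halfline f \<longleftrightarrow>
     (\<exists>D :: nat \<Rightarrow> real \<Rightarrow> real.
        D 0 = f \<and>
        (\<forall>n. \<forall>t\<ge>0. (D n has_real_derivative D (Suc n) t) (at t within {0..})))"

text \<open>
  The constancy intervals may be open, closed, half-open or reduced to a point, so that
  the values at the break points are unrestricted.
\<close>

definition piecewise_constant_on_halfline :: "(real \<Rightarrow> real) \<Rightarrow> bool" where
  "piecewise_constant_on_halfline f \<longleftrightarrow>
     (\<forall>J. is_interval J \<and> bounded J \<and> J \<subseteq> {0..} \<longrightarrow>
        (\<exists>P. finite P \<and> \<Union>P = J \<and> (\<forall>I\<in>P. is_interval I \<and> f constant_on I)))"

definition abs_continuous_on_interval :: "real \<Rightarrow> real \<Rightarrow> (real \<Rightarrow> real) \<Rightarrow> bool" where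
  "abs_continuous_on_interval a b f \<longleftrightarrow>
     (\<forall>\<epsilon>>0. \<exists>\<eta>>0. \<forall>(n::nat) x y.
        (\<forall>i<n. a \<le> x i \<and> x i \<le> y i \<and> y i \<le> b) \<and>
        (\<forall>i<n. \<forall>j<n. i \<noteq> j \<longrightarrow> {x i<..<y i} \<inter> {x j<..<y j} = {}) \<and>
        (\<Sum>i<n. y i - x i) < \<eta>
        \<longrightarrow> (\<Sum>i<n. \<bar>f (y i) - f (x i)\<bar>) < \<epsilon>)"

definition locally_abs_continuous_on_halfline :: "(real \<Rightarrow> real) \<Rightarrow> bool" where
  "locally_abs_continuous_on_halfline f \<longleftrightarrow>
     (\<forall>a b. 0 \<le> a \<and> a \<le> b \<longrightarrow> abs_continuous_on_interval a b f)"

text \<open>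
  The next three predicates say that \<open>u\<close> solves \<open>u'' + 2 \<delta> u' + \<lambda>\<^sup>2 u = 0\<close> on \<open>[0,\<infinity>)\<close>
  and that \<open>v\<close> is the (unique) derivative \<open>u'\<close> of \<open>u\<close>.
\<close>

definition classical_solution ::
  "real \<Rightarrow> (real \<Rightarrow> real) \<Rightarrow> (real \<Rightarrow> real) \<Rightarrow> (real \<Rightarrow> real) \<Rightarrow> bool" where
  "classical_solution lam \<delta> u v \<longleftrightarrow>
     (\<forall>t\<ge>0. (u has_real_derivative v t) (at t within {0..})) \<and>
     (\<forall>t\<ge>0. \<exists>w. (v has_real_derivative w) (at t within {0..}) \<and>
                w + 2 * \<delta> t * v t + lam\<^sup>2 * u t = 0)"

definition weak_solution ::
  "real \<Rightarrow> (real \<Rightarrow> real) \<Rightarrow> (real \<Rightarrow> real) \<Rightarrow> (real \<Rightarrow> real) \<Rightarrow> bool" where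
  "weak_solution lam \<delta> u v \<longleftrightarrow>
     (\<forall>t\<ge>0. (u has_real_derivative v t) (at t within {0..})) \<and>
     continuous_on {0..} v \<and>
     locally_abs_continuous_on_halfline v \<and>
     (AE t in lebesgue_on {0..}.
        \<exists>w. (v has_real_derivative w) (at t within {0..}) \<and>
            w + 2 * \<delta> t * v t + lam\<^sup>2 * u t = 0)"

definition is_solution ::
  "real \<Rightarrow> (real \<Rightarrow> real) \<Rightarrow> (real \<Rightarrow> real) \<Rightarrow> (real \<Rightarrow> real) \<Rightarrow> bool" where
  "is_solution lam \<delta> u v \<longleftrightarrow>
     (if continuous_on {0..} \<delta> then classical_solution lam \<delta> u v else weak_solution lam \<delta> u v)"

definition solutions_decay :: "real \<Rightarrow> real \<Rightarrow> real \<Rightarrow> (real \<Rightarrow> real) \<Rightarrow> bool" where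
  "solutions_decay lam R t\<^sub>0 \<delta> \<longleftrightarrow>
     (\<forall>u v. is_solution lam \<delta> u v \<longrightarrow>
        (\<forall>t\<ge>0. \<bar>v t\<bar>\<^sup>2 + lam\<^sup>2 * \<bar>u t\<bar>\<^sup>2
                 \<le> (\<bar>v 0\<bar>\<^sup>2 + lam\<^sup>2 * \<bar>u 0\<bar>\<^sup>2) * exp (- R * max (t - t\<^sub>0) 0)))"

end

theory Submission
  imports Defs
begin

text \<open>
  The energy \<open>v\<^sup>2 + lam\<^sup>2 u\<^sup>2\<close> never increases. A short and strong burst of damping
  annihilates \<open>v\<close> and hardly moves \<open>u\<close>, while a free motion of length \<open>pi / (2 lam)\<close> is a quarter
  turn that exchanges \<open>lam u\<close> and \<open>v\<close>. Hence a damping that is concentrated near the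
  multiples of \<open>t\<^sub>0\<close> acts at both ends of each period and kills both components,
  which shrinks the energy over one period by any prescribed factor.
  Such dampings are \<open>K (cos (2 lam t))\<^sup>2\<^sup>n\<close> with \<open>K\<close> and \<open>n\<close> large, and a large constant on
  the first and last of many equal parts of the period.
\<close>

section \<open>Absolutely continuous functions\<close>

text \<open>For a discontinuous damping the equation holds only almost everywhere, and an almost
  everywhere nonpositive derivative does not make a continuous function decrease: the Cantor
  function has derivative zero almost everywhere and still increases. Absolute continuity of
  \<open>v\<close> closes this gap, so the differential inequalities are turned into monotonicity of
  absolutely continuous auxiliary functions. The constants can be chosen without circularity:
  \<open>\<sigma>\<close> from \<open>R\<close> and \<open>t\<^sub>0\<close>, the width of the
  bursts from \<open>\<sigma>\<close>, and only then the strength \<open>M\<close>, which grows as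
  the width shrinks. A large \<open>M\<close> does no harm to the position, because
  \<open>\<bar>v\<bar>\<close> stays below the square root of the energy whatever the damping is.
  The delay \<open>t\<^sub>0\<close> in the final bound is the price of the last, incomplete period,
  on which the energy is only known not to increase.\<close>

lemma abs_continuous_on_interval_finite_family:
  assumes "abs_continuous_on_interval a b f" and "\<epsilon> > 0"
  shows "\<exists>\<eta>>0. \<forall>(Q :: 'i set) x y. finite Q \<and>
           (\<forall>q\<in>Q. a \<le> x q \<and> x q \<le> y q \<and> y q \<le> b) \<and>
           (\<forall>q\<in>Q. \<forall>r\<in>Q. q \<noteq> r \<longrightarrow> {x q<..<y q} \<inter> {x r<..<y r} = {}) \<and>
           (\<Sum>q\<in>Q. y q - x q) < \<eta> \<longrightarrow> (\<Sum>q\<in>Q. \<bar>f (y q) - f (x q)\<bar>) < \<epsilon>"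
proof -
  obtain \<eta> where "\<eta> > 0" and \<eta>: "\<forall>(n::nat) x y.
        (\<forall>i<n. a \<le> x i \<and> x i \<le> y i \<and> y i \<le> b) \<and>
        (\<forall>i<n. \<forall>j<n. i \<noteq> j \<longrightarrow> {x i<..<y i} \<inter> {x j<..<y j} = {}) \<and>
        (\<Sum>i<n. y i - x i) < \<eta>
        \<longrightarrow> (\<Sum>i<n. \<bar>f (y i) - f (x i)\<bar>) < \<epsilon>"
    using assms(1)[unfolded abs_continuous_on_interval_def, THEN spec, THEN mp, OF assms(2)]
    by (elim exE conjE) (rule that)
  show ?thesis
  proof (intro exI[of _ \<eta>] conjI allI impI \<open>\<eta> > 0\<close>, elim conjE)
    fix Q :: "'i set" and x y
    assume Q: "finite Q" and xy: "\<forall>q\<in>Q. a \<le> x q \<and> x q \<le> y q \<and> y q \<le> b"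
      and disj: "\<forall>q\<in>Q. \<forall>r\<in>Q. q \<noteq> r \<longrightarrow> {x q<..<y q} \<inter> {x r<..<y r} = {}"
      and small: "(\<Sum>q\<in>Q. y q - x q) < \<eta>"
    \<comment> \<open>The definition numbers its intervals, whereas a tagged division is a set of
      pairs; an enumeration of \<open>Q\<close> translates between the two.\<close>
    obtain h where h: "bij_betw h {..<card Q} Q"
      using ex_bij_betw_nat_finite[OF Q] by (auto simp: atLeast0LessThan)
    have mem: "h i \<in> Q" if "i < card Q" for i
      using h that by (auto simp: bij_betw_def)
    have inj: "h i \<noteq> h j" if "i < card Q" "j < card Q" "i \<noteq> j" for i j
      using h that by (auto simp: bij_betw_def inj_on_def)
    have "(\<Sum>i<card Q. \<bar>f (y (h i)) - f (x (h i))\<bar>) < \<epsilon>"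
    proof (rule \<eta>[THEN spec[of _ "card Q"], THEN spec[of _ "\<lambda>i. x (h i)"],
          THEN spec[of _ "\<lambda>i. y (h i)"], THEN mp], intro conjI allI impI)
      show "(\<Sum>i<card Q. y (h i) - x (h i)) < \<eta>"
        using small sum.reindex_bij_betw[OF h, of "\<lambda>q. y q - x q"] by simp
    qed (use xy mem disj inj in auto)
    then show "(\<Sum>q\<in>Q. \<bar>f (y q) - f (x q)\<bar>) < \<epsilon>"
      using sum.reindex_bij_betw[OF h, of "\<lambda>q. \<bar>f (y q) - f (x q)\<bar>"] by simp
  qed
qed

lemma abs_continuous_on_interval_continuous_on:
  assumes "abs_continuous_on_interval a b f"
  shows "continuous_on {a..b} f"
  unfolding continuous_on_iff
proof (intro ballI allI impI)
  fix x e :: real assume x: "x \<in> {a..b}" and "e > 0"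
  \<comment> \<open>Continuity concerns a single interval, so a one-point index type
    suffices.\<close>
  obtain \<eta> where "\<eta> > 0" and \<eta>: "\<forall>(Q :: unit set) x y. finite Q \<and>
           (\<forall>q\<in>Q. a \<le> x q \<and> x q \<le> y q \<and> y q \<le> b) \<and>
           (\<forall>q\<in>Q. \<forall>r\<in>Q. q \<noteq> r \<longrightarrow> {x q<..<y q} \<inter> {x r<..<y r} = {}) \<and>
           (\<Sum>q\<in>Q. y q - x q) < \<eta> \<longrightarrow> (\<Sum>q\<in>Q. \<bar>f (y q) - f (x q)\<bar>) < e"
    using abs_continuous_on_interval_finite_family[OF assms \<open>e > 0\<close>]
    by (elim exE conjE) (rule that)
  have "dist (f y) (f x) < e" if "y \<in> {a..b}" "dist y x < \<eta>" for y
  proof -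
    have "\<bar>f (max x y) - f (min x y)\<bar> < e"
      using \<eta>[THEN spec[of _ "{()}"], THEN spec[of _ "\<lambda>_. min x y"],
          THEN spec[of _ "\<lambda>_. max x y"]] x that by (auto simp: dist_real_def)
    then show ?thesis
      by (auto simp: dist_real_def max_def min_def abs_minus_commute split: if_splits)
  qed
  then show "\<exists>d>0. \<forall>y\<in>{a..b}. dist y x < d \<longrightarrow> dist (f y) (f x) < e"
    using \<open>\<eta> > 0\<close> by blast
qed

text \<open>Common source of the closure properties: Lipschitz functions (dominated by the
  identity), sums, differences and products all follow by bounding increments.\<close>

lemma abs_continuous_on_interval_dominated:
  assumes f: "abs_continuous_on_interval a b f" and g: "abs_continuous_on_interval a b g"
    and "C \<ge> 0"
    and dom: "\<And>x y. \<lbrakk>a \<le> x; x \<le> y; y \<le> b\<rbrakk> \<Longrightarrow>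
                \<bar>h y - h x\<bar> \<le> C * (\<bar>f y - f x\<bar> + \<bar>g y - g x\<bar>)"
  shows "abs_continuous_on_interval a b h"
  unfolding abs_continuous_on_interval_def
proof (intro allI impI)
  fix \<epsilon> :: real assume "\<epsilon> > 0"
  \<comment> \<open>The two families contribute \<open>e\<close> each; \<open>C + 1\<close> in place
    of \<open>C\<close> makes the final inequality strict and covers \<open>C = 0\<close>.\<close>
  define e where "e = \<epsilon> / 2 / (C + 1)"
  have "e > 0" using \<open>\<epsilon> > 0\<close> \<open>C \<ge> 0\<close> by (simp add: e_def)
  have "C + 1 \<noteq> 0" using \<open>C \<ge> 0\<close> by simp
  then have e: "e * (C + 1) = \<epsilon> / 2"
    using e_def nonzero_eq_divide_eq by blast
  obtain \<eta>1 where \<eta>1: "\<eta>1 > 0" "\<forall>(n::nat) x y.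
        (\<forall>i<n. a \<le> x i \<and> x i \<le> y i \<and> y i \<le> b) \<and>
        (\<forall>i<n. \<forall>j<n. i \<noteq> j \<longrightarrow> {x i<..<y i} \<inter> {x j<..<y j} = {}) \<and>
        (\<Sum>i<n. y i - x i) < \<eta>1 \<longrightarrow> (\<Sum>i<n. \<bar>f (y i) - f (x i)\<bar>) < e"
    using f[unfolded abs_continuous_on_interval_def, THEN spec, THEN mp, OF \<open>e > 0\<close>]
    by (elim exE conjE) (rule that)
  obtain \<eta>2 where \<eta>2: "\<eta>2 > 0" "\<forall>(n::nat) x y.
        (\<forall>i<n. a \<le> x i \<and> x i \<le> y i \<and> y i \<le> b) \<and>
        (\<forall>i<n. \<forall>j<n. i \<noteq> j \<longrightarrow> {x i<..<y i} \<inter> {x j<..<y j} = {}) \<and>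
        (\<Sum>i<n. y i - x i) < \<eta>2 \<longrightarrow> (\<Sum>i<n. \<bar>g (y i) - g (x i)\<bar>) < e"
    using g[unfolded abs_continuous_on_interval_def, THEN spec, THEN mp, OF \<open>e > 0\<close>]
    by (elim exE conjE) (rule that)
  show "\<exists>\<eta>>0. \<forall>(n::nat) x y.
        (\<forall>i<n. a \<le> x i \<and> x i \<le> y i \<and> y i \<le> b) \<and>
        (\<forall>i<n. \<forall>j<n. i \<noteq> j \<longrightarrow> {x i<..<y i} \<inter> {x j<..<y j} = {}) \<and>
        (\<Sum>i<n. y i - x i) < \<eta> \<longrightarrow> (\<Sum>i<n. \<bar>h (y i) - h (x i)\<bar>) < \<epsilon>"
  proof (intro exI[of _ "min \<eta>1 \<eta>2"] conjI allI impI)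
    show "min \<eta>1 \<eta>2 > 0" using \<eta>1 \<eta>2 by simp
    fix n :: nat and x y
    assume *: "(\<forall>i<n. a \<le> x i \<and> x i \<le> y i \<and> y i \<le> b) \<and>
        (\<forall>i<n. \<forall>j<n. i \<noteq> j \<longrightarrow> {x i<..<y i} \<inter> {x j<..<y j} = {}) \<and>
        (\<Sum>i<n. y i - x i) < min \<eta>1 \<eta>2"
    have "(\<Sum>i<n. \<bar>h (y i) - h (x i)\<bar>)
        \<le> (\<Sum>i<n. C * (\<bar>f (y i) - f (x i)\<bar> + \<bar>g (y i) - g (x i)\<bar>))"
      using * by (intro sum_mono dom) auto
    also have "\<dots> = C * ((\<Sum>i<n. \<bar>f (y i) - f (x i)\<bar>) + (\<Sum>i<n. \<bar>g (y i) - g (x i)\<bar>))"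
      by (simp only: sum.distrib flip: sum_distrib_left)
    also have "\<dots> \<le> C * (e + e)"
      using \<eta>1(2)[THEN spec[of _ n], THEN spec[of _ x], THEN spec[of _ y]]
        \<eta>2(2)[THEN spec[of _ n], THEN spec[of _ x], THEN spec[of _ y]] * \<open>C \<ge> 0\<close> by (intro mult_left_mono) auto
    also have "\<dots> < (C + 1) * (e + e)"
      using \<open>e > 0\<close> by simp
    also have "\<dots> = \<epsilon>"
      using e by (simp add: algebra_simps)
    finally show "(\<Sum>i<n. \<bar>h (y i) - h (x i)\<bar>) < \<epsilon>" .
  qed
qed

lemma abs_continuous_on_interval_id: "abs_continuous_on_interval a b (\<lambda>x. x)"
  unfolding abs_continuous_on_interval_def
proof (intro allI impI exI conjI)
  fix e :: real and n :: nat and x y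
  assume "0 < e" and *: "(\<forall>i<n. a \<le> x i \<and> x i \<le> y i \<and> y i \<le> b) \<and>
        (\<forall>i<n. \<forall>j<n. i \<noteq> j \<longrightarrow> {x i<..<y i} \<inter> {x j<..<y j} = {}) \<and>
        (\<Sum>i<n. y i - x i) < e"
  have "(\<Sum>i<n. \<bar>y i - x i\<bar>) = (\<Sum>i<n. y i - x i)"
    using * by (intro sum.cong) auto
  with * show "(\<Sum>i<n. \<bar>y i - x i\<bar>) < e" by simp
qed

lemma abs_continuous_on_interval_bounded_derivative:
  assumes deriv: "\<And>x. x \<in> {a..b} \<Longrightarrow> (f has_real_derivative f' x) (at x within {a..b})"
    and "continuous_on {a..b} f'"
  shows "abs_continuous_on_interval a b f"
proof -
  obtain B where "B > 0" and B: "\<And>x. x \<in> {a..b} \<Longrightarrow> \<bar>f' x\<bar> \<le> B"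
    using compact_imp_bounded[OF compact_continuous_image[OF assms(2) compact_Icc]]
    unfolding bounded_pos by auto
  have "\<bar>f y - f x\<bar> \<le> B * \<bar>y - x\<bar>" if "a \<le> x" "x \<le> y" "y \<le> b" for x y
    using field_differentiable_bound[of "{a..b}" f f' B y x] deriv B that by auto
  then have "\<bar>f y - f x\<bar> \<le> B * (\<bar>y - x\<bar> + \<bar>y - x\<bar>)" if "a \<le> x" "x \<le> y" "y \<le> b" for x y
    using that \<open>B > 0\<close> by (smt (verit) mult_left_mono)
  then show ?thesis
    using abs_continuous_on_interval_dominated[OF abs_continuous_on_interval_id
        abs_continuous_on_interval_id] \<open>B > 0\<close> by (meson less_imp_le)
qed

lemma abs_continuous_on_interval_const: "abs_continuous_on_interval a b (\<lambda>t. c)"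
  by (rule abs_continuous_on_interval_bounded_derivative[where f' = "\<lambda>_. 0"]) auto

lemma abs_continuous_on_interval_add:
  assumes "abs_continuous_on_interval a b f" "abs_continuous_on_interval a b g"
  shows "abs_continuous_on_interval a b (\<lambda>x. f x + g x)"
  by (rule abs_continuous_on_interval_dominated[OF assms, of 1]) auto

lemma abs_continuous_on_interval_diff:
  assumes "abs_continuous_on_interval a b f" "abs_continuous_on_interval a b g"
  shows "abs_continuous_on_interval a b (\<lambda>x. f x - g x)"
  by (rule abs_continuous_on_interval_dominated[OF assms, of 1]) auto

lemma abs_continuous_on_interval_minus:
  assumes "abs_continuous_on_interval a b f"
  shows "abs_continuous_on_interval a b (\<lambda>x. - f x)"
  by (rule abs_continuous_on_interval_dominated[OF assms assms, of 1]) (auto simp: abs_if)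

text \<open>Both factors are bounded on the compact interval, and the increment of the product
  splits as in the Leibniz rule.\<close>

lemma abs_continuous_on_interval_mult:
  assumes f: "abs_continuous_on_interval a b f" and g: "abs_continuous_on_interval a b g"
  shows "abs_continuous_on_interval a b (\<lambda>x. f x * g x)"
proof -
  have bdd: "\<exists>B>0. \<forall>x\<in>{a..b}. \<bar>h x\<bar> \<le> B" if "abs_continuous_on_interval a b h" for h
    using compact_imp_bounded[OF compact_continuous_image[OF
        abs_continuous_on_interval_continuous_on[OF that] compact_Icc]]
    unfolding bounded_pos by auto
  obtain A where "A > 0" and A: "\<And>x. x \<in> {a..b} \<Longrightarrow> \<bar>f x\<bar> \<le> A"
    using bdd[OF f] by blast
  obtain B where "B > 0" and B: "\<And>x. x \<in> {a..b} \<Longrightarrow> \<bar>g x\<bar> \<le> B"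
    using bdd[OF g] by blast
  show ?thesis
  proof (rule abs_continuous_on_interval_dominated[OF f g])
    show "A + B \<ge> 0" using \<open>A > 0\<close> \<open>B > 0\<close> by simp
    fix x y assume xy: "a \<le> x" "x \<le> y" "y \<le> b"
    have "f y * g y - f x * g x = f y * (g y - g x) + g x * (f y - f x)"
      by (simp add: algebra_simps)
    then have "\<bar>f y * g y - f x * g x\<bar> \<le> \<bar>f y\<bar> * \<bar>g y - g x\<bar> + \<bar>g x\<bar> * \<bar>f y - f x\<bar>"
      by (metis abs_mult abs_triangle_ineq)
    also have "\<dots> \<le> (A + B) * \<bar>g y - g x\<bar> + (A + B) * \<bar>f y - f x\<bar>"
      using A[of y] B[of x] xy \<open>A > 0\<close> \<open>B > 0\<close>
      by (intro add_mono mult_right_mono) auto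
    finally show "\<bar>f y * g y - f x * g x\<bar> \<le> (A + B) * (\<bar>f y - f x\<bar> + \<bar>g y - g x\<bar>)"
      by (simp add: algebra_simps)
  qed
qed

lemma abs_continuous_on_interval_power2:
  assumes "abs_continuous_on_interval a b f"
  shows "abs_continuous_on_interval a b (\<lambda>x. (f x)\<^sup>2)"
  unfolding power2_eq_square by (intro abs_continuous_on_interval_mult assms)

text \<open>On a fine tagged division the increments over intervals tagged outside the exceptional set are
  controlled by the derivative; the remaining intervals lie in an open set of small measure,
  so absolute continuity makes their total increment small.\<close>

lemma abs_continuous_ae_nonpos_derivative_imp_le:
  assumes ac: "abs_continuous_on_interval a b f" and "a \<le> b" and "negligible N"
    and deriv: "\<And>x. x \<in> {a<..<b} - N \<Longrightarrow>
                  \<exists>d\<le>0. (f has_real_derivative d) (at x within {a..b})"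
  shows "f b \<le> f a"
proof -
  \<comment> \<open>The term \<open>e * (b - a)\<close> pays for the intervals with good tags, the
    last \<open>e\<close> for those tagged in the exceptional set.\<close>
  have small: "f b - f a \<le> e * (b - a) + e" if "e > 0" for e :: real
  proof -
    obtain \<eta> where "\<eta> > 0" and \<eta>: "\<forall>(Q :: (real \<times> real set) set) x y. finite Q \<and>
           (\<forall>q\<in>Q. a \<le> x q \<and> x q \<le> y q \<and> y q \<le> b) \<and>
           (\<forall>q\<in>Q. \<forall>r\<in>Q. q \<noteq> r \<longrightarrow> {x q<..<y q} \<inter> {x r<..<y r} = {}) \<and>
           (\<Sum>q\<in>Q. y q - x q) < \<eta> \<longrightarrow> (\<Sum>q\<in>Q. \<bar>f (y q) - f (x q)\<bar>) < e"
    using abs_continuous_on_interval_finite_family[OF ac \<open>e > 0\<close>]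
    by (elim exE conjE) (rule that)
    \<comment> \<open>The derivative is only given in the open interval, so the endpoints join the
      exceptional set.\<close>
    define N' where "N' = N \<union> {a, b}"
    have "negligible N'"
      using \<open>negligible N\<close> by (auto simp: N'_def)
    then have N': "N' \<in> lmeasurable" "measure lebesgue N' = 0"
      by (auto simp: negligible_iff_measure)
    obtain G where G: "open G" "N' \<subseteq> G" "G \<in> lmeasurable" "measure lebesgue G < \<eta>"
    proof -
      obtain G where "open G" "N' \<subseteq> G" "G - N' \<in> lmeasurable"
        "emeasure lebesgue (G - N') < ennreal \<eta>"
        using sets_lebesgue_outer_open[of N' \<eta>] N' \<open>\<eta> > 0\<close> by (auto simp: fmeasurableD)
      moreover have "G = N' \<union> (G - N')" using \<open>N' \<subseteq> G\<close> by auto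
      ultimately have "G \<in> lmeasurable" "measure lebesgue G \<le> 0 + measure lebesgue (G - N')"
        using N' fmeasurable.Un measure_Un_le[of N' lebesgue "G - N'"]
        by (metis fmeasurableD)+
      moreover have "measure lebesgue (G - N') < \<eta>"
        using \<open>emeasure lebesgue (G - N') < ennreal \<eta>\<close> \<open>G - N' \<in> lmeasurable\<close> \<open>\<eta> > 0\<close>
        by (simp add: emeasure_eq_measure2 ennreal_less_iff)
      ultimately show thesis
        using that \<open>open G\<close> \<open>N' \<subseteq> G\<close> by auto
    qed
    \<comment> \<open>The estimate is split into the two sides of the tag \<open>x\<close>; adding
      them bounds the increment over an interval that contains \<open>x\<close>, although the
      derivative is known at \<open>x\<close> alone.\<close>
    have "\<exists>r>0. (x \<in> N' \<longrightarrow> ball x r \<subseteq> G) \<and>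
            (x \<in> {a..b} - N' \<longrightarrow> (\<forall>y\<in>{a..b}. dist y x < r \<longrightarrow>
                 (x \<le> y \<longrightarrow> f y - f x \<le> e * (y - x)) \<and>
                 (y \<le> x \<longrightarrow> f x - f y \<le> e * (x - y))))" for x
    proof (cases "x \<in> N'")
      case True
      then show ?thesis using G by (meson Diff_iff openE subsetD)
    next
      case False
      show ?thesis
      proof (cases "x \<in> {a..b}")
        case True
        then obtain d where "d \<le> 0" and d: "(f has_real_derivative d) (at x within {a..b})"
          using deriv[of x] False by (force simp: N'_def)
        obtain r where "r > 0" and r: "\<And>y. \<lbrakk>y \<in> {a..b}; norm (y - x) < r\<rbrakk> \<Longrightarrow>
            norm (f y - f x - d * (y - x)) \<le> e * norm (y - x)"
          using d \<open>e > 0\<close> unfolding has_field_derivative_def has_derivative_within_alt by metis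
        have "f y - f x \<le> e * (y - x)" if "y \<in> {a..b}" "dist y x < r" "x \<le> y" for y
          using r[of y] that mult_nonpos_nonneg[OF \<open>d \<le> 0\<close>, of "y - x"]
          by (auto simp: dist_real_def)
        moreover have "f x - f y \<le> e * (x - y)" if "y \<in> {a..b}" "dist y x < r" "y \<le> x" for y
          using r[of y] that mult_nonpos_nonpos[OF \<open>d \<le> 0\<close>, of "y - x"]
          by (auto simp: dist_real_def)
        ultimately show ?thesis
          using \<open>r > 0\<close> False by blast
      qed (use False zero_less_one in blast)
    qed
    then obtain r where r: "\<And>x. r x > 0" "\<And>x. x \<in> N' \<Longrightarrow> ball x (r x) \<subseteq> G"
      "\<And>x y. \<lbrakk>x \<in> {a..b} - N'; y \<in> {a..b}; dist y x < r x; x \<le> y\<rbrakk> \<Longrightarrow> f y - f x \<le> e * (y - x)"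
      "\<And>x y. \<lbrakk>x \<in> {a..b} - N'; y \<in> {a..b}; dist y x < r x; y \<le> x\<rbrakk> \<Longrightarrow> f x - f y \<le> e * (x - y)"
      by metis
    have "gauge (\<lambda>x. ball x (r x))" using r(1) by (intro gauge_ball_dependent) auto
    then obtain p where p: "p tagged_division_of {a..b}" "(\<lambda>x. ball x (r x)) fine p"
      using fine_division_exists_real by blast
    note pD = tagged_division_ofD[OF p(1)]
    have "finite p" by (rule pD)
    have K: "K = {Inf K..Sup K}" "Inf K \<le> x" "x \<le> Sup K" "a \<le> Inf K" "Sup K \<le> b"
      "x \<in> {a..b}" "K \<subseteq> ball x (r x)"
      if xK: "(x, K) \<in> p" for x K
    proof -
      obtain c d where "K = cbox c d" using pD(4)[OF xK] by blast
      moreover have "x \<in> K" "K \<subseteq> {a..b}" using pD(2,3)[OF xK] by auto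
      ultimately show "K = {Inf K..Sup K}" "Inf K \<le> x" "x \<le> Sup K" "a \<le> Inf K" "Sup K \<le> b"
        "x \<in> {a..b}" by auto
      show "K \<subseteq> ball x (r x)" using p(2) xK by (auto simp: fine_def)
    qed
    have disj: "interior K \<inter> interior L = {}" if "(x, K) \<in> p" "(y, L) \<in> p" "(x, K) \<noteq> (y, L)"
      for x y K L
      using pD(5) that by blast
    define Q where "Q = {q \<in> p. fst q \<in> N'}"
    have "finite Q" "Q \<subseteq> p" using \<open>finite p\<close> by (auto simp: Q_def)
    have "(\<Sum>q\<in>Q. Sup (snd q) - Inf (snd q)) = (\<Sum>q\<in>Q. measure lebesgue (snd q))"
    proof (rule sum.cong[OF refl])
      fix q assume "q \<in> Q"
      then have *: "(fst q, snd q) \<in> p" using \<open>Q \<subseteq> p\<close> by auto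
      have "measure lebesgue {Inf (snd q)..Sup (snd q)} = Sup (snd q) - Inf (snd q)"
        using K(2,3)[OF *] by simp
      then show "Sup (snd q) - Inf (snd q) = measure lebesgue (snd q)"
        using K(1)[OF *] by simp
    qed
    also have "\<dots> = measure lebesgue (\<Union>(snd ` Q))"
    proof (rule measure_negligible_finite_Union_image[symmetric, OF \<open>finite Q\<close>])
      show "snd q \<in> lmeasurable" if "q \<in> Q" for q
        using K(1)[of "fst q" "snd q"] that \<open>Q \<subseteq> p\<close> lmeasurable_interval(1)
        by (metis prod.collapse subsetD)
      show "pairwise (\<lambda>q r. negligible (snd q \<inter> snd r)) Q"
      proof (rule pairwiseI)
        fix q r assume "q \<in> Q" "r \<in> Q" "q \<noteq> r"
        then have *: "(fst q, snd q) \<in> p" "(fst r, snd r) \<in> p" "(fst q, snd q) \<noteq> (fst r, snd r)"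
          using \<open>Q \<subseteq> p\<close> by (auto simp: prod_eq_iff)
        have "convex (snd q \<inter> snd r)"
          using K(1)[OF *(1)] K(1)[OF *(2)] by (metis convex_Int convex_real_interval(5))
        moreover have "interior (snd q \<inter> snd r) = {}"
          using disj[OF *] by simp
        ultimately show "negligible (snd q \<inter> snd r)"
          using negligible_convex_interior by blast
      qed
    qed
    also have "\<dots> \<le> measure lebesgue G"
    proof (rule measure_mono_fmeasurable)
      show "\<Union> (snd ` Q) \<subseteq> G" using K(7) r(2) by (fastforce simp: Q_def)
      have "snd q \<in> sets lebesgue" if "q \<in> Q" for q
        using K(1)[of "fst q" "snd q"] that \<open>Q \<subseteq> p\<close> lmeasurable_interval(1)
        by (metis fmeasurableD prod.collapse subsetD)
      then show "\<Union> (snd ` Q) \<in> sets lebesgue" using \<open>finite Q\<close> by auto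
    qed (use G in auto)
    finally have "(\<Sum>q\<in>Q. Sup (snd q) - Inf (snd q)) < \<eta>" using G by simp
    then have "(\<Sum>q\<in>Q. \<bar>f (Sup (snd q)) - f (Inf (snd q))\<bar>) < e"
    proof (intro \<eta>[rule_format] conjI ballI impI \<open>finite Q\<close>)
      show "a \<le> Inf (snd q)" "Inf (snd q) \<le> Sup (snd q)" "Sup (snd q) \<le> b" if "q \<in> Q" for q
        using K(2-5)[of "fst q" "snd q"] that \<open>Q \<subseteq> p\<close> by force+
      fix q r assume "q \<in> Q" "r \<in> Q" "q \<noteq> r"
      then have *: "(fst q, snd q) \<in> p" "(fst r, snd r) \<in> p" "(fst q, snd q) \<noteq> (fst r, snd r)"
        using \<open>Q \<subseteq> p\<close> by (auto simp: prod_eq_iff)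
      show "{Inf (snd q)<..<Sup (snd q)} \<inter> {Inf (snd r)<..<Sup (snd r)} = {}"
        using disj[OF *] K(1)[OF *(1)] K(1)[OF *(2)]
        by (metis interior_atLeastAtMost_real)
    qed
    then have 1: "(\<Sum>q\<in>Q. f (Sup (snd q)) - f (Inf (snd q))) \<le> e"
      by (smt (verit) sum_mono)
    have "(\<Sum>q\<in>p - Q. f (Sup (snd q)) - f (Inf (snd q)))
        \<le> (\<Sum>q\<in>p - Q. e * Sup (snd q) - e * Inf (snd q))"
    proof (rule sum_mono)
      fix q assume "q \<in> p - Q"
      then have *: "(fst q, snd q) \<in> p" "fst q \<in> {a..b} - N'"
        using K(6)[of "fst q" "snd q"] by (auto simp: Q_def)
      define x c d where "x = fst q" and "c = Inf (snd q)" and "d = Sup (snd q)"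
      have "{c..d} \<subseteq> ball x (r x)" "c \<le> x" "x \<le> d" "a \<le> c" "d \<le> b"
        using K[OF *(1)] by (auto simp: x_def c_def d_def)
      then have "dist c x < r x" "dist d x < r x"
        by (auto simp: dist_commute subset_iff)
      then have "f d - f x \<le> e * (d - x)" "f x - f c \<le> e * (x - c)"
        using r(3)[of x d] r(4)[of x c] *(2) \<open>c \<le> x\<close> \<open>x \<le> d\<close> \<open>a \<le> c\<close> \<open>d \<le> b\<close>
        by (auto simp: x_def)
      then show "f (Sup (snd q)) - f (Inf (snd q)) \<le> e * Sup (snd q) - e * Inf (snd q)"
        by (simp add: c_def d_def algebra_simps)
    qed
    \<comment> \<open>Restoring the discarded intervals adds nonnegative terms and makes the sum
      telescope.\<close>
    also have "\<dots> \<le> (\<Sum>q\<in>p. e * Sup (snd q) - e * Inf (snd q))"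
    proof (rule sum_mono2[OF \<open>finite p\<close>])
      fix q assume "q \<in> p - (p - Q)"
      then have "Inf (snd q) \<le> Sup (snd q)" using K(2,3)[of "fst q" "snd q"] by auto
      then show "0 \<le> e * Sup (snd q) - e * Inf (snd q)" using \<open>e > 0\<close> by simp
    qed auto
    also have "\<dots> = e * b - e * a"
      using additive_tagged_division_1[OF \<open>a \<le> b\<close> p(1), of "\<lambda>x. e * x"]
      by (simp add: case_prod_unfold)
    finally have 2: "(\<Sum>q\<in>p - Q. f (Sup (snd q)) - f (Inf (snd q))) \<le> e * b - e * a" .
    have "f b - f a = (\<Sum>q\<in>p. f (Sup (snd q)) - f (Inf (snd q)))"
      using additive_tagged_division_1[OF \<open>a \<le> b\<close> p(1), of f] by (simp add: case_prod_unfold)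
    also have "\<dots> = (\<Sum>q\<in>p - Q. f (Sup (snd q)) - f (Inf (snd q)))
                  + (\<Sum>q\<in>Q. f (Sup (snd q)) - f (Inf (snd q)))"
      using sum.subset_diff[OF \<open>Q \<subseteq> p\<close> \<open>finite p\<close>] .
    finally show ?thesis using 1 2 by (simp add: algebra_simps)
  qed
  show ?thesis
  proof (rule ccontr)
    assume "\<not> f b \<le> f a"
    \<comment> \<open>With this value \<open>small\<close> bounds \<open>f b - f a\<close> by its
      own half.\<close>
    define e where "e = (f b - f a) / (2 * (b - a + 1))"
    have "e > 0" using \<open>\<not> f b \<le> f a\<close> \<open>a \<le> b\<close> by (simp add: e_def)
    have "f b - f a \<le> e * (b - a + 1)" using small[OF \<open>e > 0\<close>] by (simp add: algebra_simps)
    also have "\<dots> = (f b - f a) / 2" using \<open>a \<le> b\<close> by (simp add: e_def field_simps)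
    finally show False using \<open>\<not> f b \<le> f a\<close> by simp
  qed
qed

section \<open>Energy estimates\<close>

lemma one_minus_cos_le:
  fixes x :: real
  assumes "x \<ge> 0"
  shows "1 - cos x \<le> x"
proof -
  have "1 - cos x = 2 * (sin (x / 2))\<^sup>2"
    using cos_double_sin[of "x / 2"] by simp
  also have "\<dots> \<le> 2 * \<bar>sin (x / 2)\<bar>"
    using power_decreasing[of 1 2 "\<bar>sin (x / 2)\<bar>"] by simp
  also have "\<dots> \<le> x"
    using abs_sin_x_le_abs_x[of "x / 2"] assms by simp
  finally show ?thesis .
qed

section \<open>Dissipation and rotation in the phase plane\<close>

text \<open>Common ground of classical and weak solutions: the equation is solved for the derivative
  of \<open>v\<close> and holds off the null set \<open>N\<close>.\<close>

locale damped_oscillator =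
  fixes lam :: real and \<delta> u v :: "real \<Rightarrow> real" and N :: "real set"
  assumes lam_pos: "lam > 0"
    and damping_nonneg: "t \<ge> 0 \<Longrightarrow> \<delta> t \<ge> 0"
    and u_deriv: "t \<ge> 0 \<Longrightarrow> (u has_real_derivative v t) (at t within {0..})"
    and v_ac: "locally_abs_continuous_on_halfline v"
    and negligible_N: "negligible N"
    and v_deriv: "\<lbrakk>t \<ge> 0; t \<notin> N\<rbrakk> \<Longrightarrow>
      (v has_real_derivative - (2 * \<delta> t * v t) - lam\<^sup>2 * u t) (at t within {0..})"
begin

text \<open>The squared distance from the origin of the phase point with coordinates
  \<open>lam * u\<close> and \<open>v\<close>.\<close>

definition energy :: "real \<Rightarrow> real" where
  "energy t = (v t)\<^sup>2 + lam\<^sup>2 * (u t)\<^sup>2"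

lemma energy_nonneg: "0 \<le> energy t"
  by (simp add: energy_def)

text \<open>The hypothesis speaks of \<open>a \<le> b\<close> only. For \<open>b < a\<close> the
  interval is empty and any function qualifies, which frees \<open>ac_intros\<close> from a side
  condition.\<close>

lemma ac_v: "0 \<le> a \<Longrightarrow> abs_continuous_on_interval a b v"
proof (cases "a \<le> b")
  case False
  assume "0 \<le> a"
  have "abs_continuous_on_interval a b f" for f
    using False by (intro abs_continuous_on_interval_bounded_derivative) auto
  then show ?thesis .
qed (use v_ac in \<open>simp add: locally_abs_continuous_on_halfline_def\<close>)

lemma u_deriv_within:
  assumes "0 \<le> a" "t \<in> {a..b}"
  shows "(u has_real_derivative v t) (at t within {a..b})"
  by (rule has_field_derivative_subset[OF u_deriv]) (use assms in auto)

lemma ac_u: "0 \<le> a \<Longrightarrow> abs_continuous_on_interval a b u"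
  using abs_continuous_on_interval_bounded_derivative u_deriv_within
    abs_continuous_on_interval_continuous_on[OF ac_v] by blast

lemma nonincreasing:
  assumes "0 \<le> a" "a \<le> b" and ac: "abs_continuous_on_interval a b f"
    and deriv: "\<And>t. \<lbrakk>a < t; t < b; t \<notin> N\<rbrakk> \<Longrightarrow> (f has_real_derivative d t) (at t within {0..})"
    and nonpos: "\<And>t. \<lbrakk>a < t; t < b; t \<notin> N\<rbrakk> \<Longrightarrow> d t \<le> 0"
  shows "f b \<le> f a"
proof (rule abs_continuous_ae_nonpos_derivative_imp_le[OF ac \<open>a \<le> b\<close> negligible_N])
  fix t assume t: "t \<in> {a<..<b} - N"
  show "\<exists>d\<le>0. (f has_real_derivative d) (at t within {a..b})"
    using t deriv[of t] nonpos[of t] \<open>0 \<le> a\<close>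
    by (intro exI[of _ "d t"]) (auto intro: has_field_derivative_subset)
qed

lemmas ac_intros = abs_continuous_on_interval_add abs_continuous_on_interval_diff
  abs_continuous_on_interval_minus abs_continuous_on_interval_mult
  abs_continuous_on_interval_power2 abs_continuous_on_interval_id
  abs_continuous_on_interval_const ac_u ac_v

text \<open>The coupling terms in \<open>u * v\<close> cancel, and the damping leaves
  \<open>- 4 * \<delta> * v^2\<close>.\<close>

lemma energy_antimono:
  assumes "0 \<le> a" "a \<le> b"
  shows "energy b \<le> energy a"
proof (rule nonincreasing[OF assms, where d = "\<lambda>t. - 4 * \<delta> t * (v t)\<^sup>2"])
  show "abs_continuous_on_interval a b energy"
    unfolding energy_def by (intro ac_intros assms)
  fix t assume t: "a < t" "t < b" "t \<notin> N"
  note [derivative_intros] = u_deriv[of t] v_deriv[of t]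
  show "(energy has_real_derivative - 4 * \<delta> t * (v t)\<^sup>2) (at t within {0..})"
    unfolding energy_def using t assms
    by (auto intro!: derivative_eq_intros simp: algebra_simps power2_eq_square)
  show "- 4 * \<delta> t * (v t)\<^sup>2 \<le> 0"
    using damping_nonneg[of t] t assms by simp
qed

text \<open>The left side is the part of the derivative of \<open>v^2\<close> that is fed by the
  position; the square of \<open>v + lam * u\<close> bounds it by \<open>lam\<close> times the
  energy.\<close>

lemma coupling_le:
  assumes "0 \<le> c" "c \<le> t" "energy c \<le> e"
  shows "- (2 * lam\<^sup>2 * u t * v t) \<le> lam * e"
proof -
  have "0 \<le> (v t + lam * u t)\<^sup>2" by simp
  then have "- (2 * lam * u t * v t) \<le> energy t"
    by (simp add: energy_def power2_sum power_mult_distrib algebra_simps)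
  also have "\<dots> \<le> e" using energy_antimono[OF assms(1,2)] assms(3) by simp
  finally have "lam * - (2 * lam * u t * v t) \<le> lam * e"
    using lam_pos by (intro mult_left_mono) auto
  then show ?thesis by (simp add: power2_eq_square algebra_simps)
qed

text \<open>Serves the transition zone behind a burst, where the damping has no useful lower bound:
  dissipation can only help, and the coupling feeds \<open>v^2\<close> at rate at most
  \<open>lam * e\<close>.\<close>

lemma velocity_squared_growth:
  assumes "0 \<le> c" "c \<le> d" "energy c \<le> e"
  shows "(v d)\<^sup>2 \<le> (v c)\<^sup>2 + lam * e * (d - c)"
proof -
  let ?f = "\<lambda>t. (v t)\<^sup>2 - lam * e * t"
  have "?f d \<le> ?f c"
  proof (rule nonincreasing[OF assms(1,2),
        where d = "\<lambda>t. - 4 * \<delta> t * (v t)\<^sup>2 - 2 * lam\<^sup>2 * u t * v t - lam * e"])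
    show "abs_continuous_on_interval c d ?f"
      by (intro ac_intros assms)
    fix t assume t: "c < t" "t < d" "t \<notin> N"
    note [derivative_intros] = u_deriv[of t] v_deriv[of t]
    show "(?f has_real_derivative - 4 * \<delta> t * (v t)\<^sup>2 - 2 * lam\<^sup>2 * u t * v t - lam * e)
            (at t within {0..})"
      using t assms by (auto intro!: derivative_eq_intros simp: algebra_simps power2_eq_square)
    have "0 \<le> 4 * \<delta> t * (v t)\<^sup>2"
      using damping_nonneg[of t] t assms by simp
    then show "- 4 * \<delta> t * (v t)\<^sup>2 - 2 * lam\<^sup>2 * u t * v t - lam * e \<le> 0"
      using coupling_le[of c t e] t assms by simp
  qed
  then show ?thesis by (simp add: algebra_simps)
qed

text \<open>Gronwall for \<open>y = v^2\<close>, which satisfies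
  \<open>y' \<le> - 4 * M * y + lam * e\<close> almost everywhere.\<close>

lemma velocity_squared_damping:
  assumes "0 \<le> c" "c \<le> d" "energy c \<le> e" "M > 0"
    and strong: "\<And>t. \<lbrakk>c < t; t < d\<rbrakk> \<Longrightarrow> M \<le> \<delta> t"
  shows "(v d)\<^sup>2 \<le> exp (- 4 * M * (d - c)) * e + lam * e / (4 * M)"
proof -
  \<comment> \<open>The equilibrium of \<open>y' = - 4 * M * y + lam * e\<close>; the integrating
    factor is applied to the distance from it.\<close>
  define k where "k = lam * e / (4 * M)"
  have k: "4 * M * k = lam * e" using \<open>M > 0\<close> by (simp add: k_def)
  have "k \<ge> 0" using energy_nonneg[of c] assms(3,4) lam_pos by (simp add: k_def)
  let ?f = "\<lambda>t. exp (4 * M * t) * ((v t)\<^sup>2 - k)"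
  let ?d = "\<lambda>t. exp (4 * M * t) *
    (4 * M * (v t)\<^sup>2 - lam * e - 4 * \<delta> t * (v t)\<^sup>2 - 2 * lam\<^sup>2 * u t * v t)"
  have "?f d \<le> ?f c"
  proof (rule nonincreasing[OF assms(1,2), where d = ?d])
    have "abs_continuous_on_interval c d (\<lambda>t. exp (4 * M * t))"
      by (rule abs_continuous_on_interval_bounded_derivative[where f' = "\<lambda>t. exp (4 * M * t) * (4 * M)"])
        (auto intro!: derivative_eq_intros continuous_intros)
    then show "abs_continuous_on_interval c d ?f"
      by (intro ac_intros assms)
    fix t assume t: "c < t" "t < d" "t \<notin> N"
    note [derivative_intros] = u_deriv[of t] v_deriv[of t]
    show "(?f has_real_derivative ?d t) (at t within {0..})"
      unfolding k[symmetric] using t assms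
      by (auto intro!: derivative_eq_intros simp: algebra_simps power2_eq_square)
    have "M * (v t)\<^sup>2 \<le> \<delta> t * (v t)\<^sup>2"
      using strong[of t] t by (intro mult_right_mono) auto
    then show "?d t \<le> 0"
      using coupling_le[of c t e] t assms by (intro mult_nonneg_nonpos) auto
  qed
  then have "exp (- 4 * M * d) * ?f d \<le> exp (- 4 * M * d) * ?f c"
    by (intro mult_left_mono) auto
  then have "(v d)\<^sup>2 - k \<le> exp (- 4 * M * (d - c)) * ((v c)\<^sup>2 - k)"
    by (simp only: mult.assoc[symmetric] exp_add[symmetric]) (simp add: algebra_simps)
  also have "\<dots> \<le> exp (- 4 * M * (d - c)) * e"
  proof (rule mult_left_mono)
    have "(v c)\<^sup>2 \<le> energy c" by (simp add: energy_def)
    then show "(v c)\<^sup>2 - k \<le> e" using assms(3) \<open>k \<ge> 0\<close> by simp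
  qed simp
  finally show ?thesis by (simp add: k_def)
qed

lemma abs_velocity_le:
  assumes "0 \<le> c" "c \<le> t"
  shows "\<bar>v t\<bar> \<le> sqrt (energy c)"
proof -
  have "(v t)\<^sup>2 \<le> energy t" by (simp add: energy_def)
  then show ?thesis using energy_antimono[OF assms] by (simp add: real_le_rsqrt)
qed

lemma abs_position_le:
  assumes "0 \<le> c" "c \<le> t"
  shows "lam * \<bar>u t\<bar> \<le> sqrt (energy c)"
proof -
  have "(lam * \<bar>u t\<bar>)\<^sup>2 \<le> energy t" by (simp add: energy_def power_mult_distrib)
  then show ?thesis using energy_antimono[OF assms] by (simp add: real_le_rsqrt)
qed

lemma position_drift:
  assumes "0 \<le> s" "s \<le> c" "c \<le> d"
  shows "\<bar>u d - u c\<bar> \<le> sqrt (energy s) * (d - c)"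
proof -
  have "\<bar>u d - u c\<bar> \<le> sqrt (energy s) * \<bar>d - c\<bar>"
    using field_differentiable_bound[of "{c..d}" u v "sqrt (energy s)" d c]
      abs_velocity_le[of s] u_deriv_within[of c _ d] assms by auto
  then show ?thesis using assms by simp
qed

text \<open>The undamped flow is a rotation of the point with coordinates \<open>lam u\<close> and \<open>v\<close>;
  \<open>rotating s\<close> is the \<open>v\<close>-component at time \<open>s\<close> of the undamped orbit through the
  current point. It changes only through the damping.\<close>

definition rotating :: "real \<Rightarrow> real \<Rightarrow> real" where
  "rotating s t = lam * u t * sin (lam * (t - s)) + v t * cos (lam * (t - s))"

lemma rotating_drift:
  assumes "0 \<le> s" "s \<le> c" "c \<le> d"
    and weak: "\<And>t. \<lbrakk>c < t; t < d\<rbrakk> \<Longrightarrow> \<delta> t \<le> \<eta>"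
  shows "\<bar>rotating s d - rotating s c\<bar> \<le> 2 * \<eta> * sqrt (energy s) * (d - c)"
proof -
  let ?r = "2 * \<eta> * sqrt (energy s)"
  have "0 \<le> c" using assms by simp
  have ac: "abs_continuous_on_interval c d (rotating s)"
  proof -
    have "abs_continuous_on_interval c d (\<lambda>t. sin (lam * (t - s)))"
      by (rule abs_continuous_on_interval_bounded_derivative[where f' = "\<lambda>t. cos (lam * (t - s)) * lam"])
        (auto intro!: derivative_eq_intros continuous_intros)
    moreover have "abs_continuous_on_interval c d (\<lambda>t. cos (lam * (t - s)))"
      by (rule abs_continuous_on_interval_bounded_derivative[where f' = "\<lambda>t. - sin (lam * (t - s)) * lam"])
        (auto intro!: derivative_eq_intros continuous_intros)
    ultimately show ?thesis
      unfolding rotating_def by (intro ac_intros \<open>0 \<le> c\<close>)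
  qed
  let ?d = "\<lambda>t. - 2 * \<delta> t * v t * cos (lam * (t - s))"
  have deriv: "(rotating s has_real_derivative ?d t) (at t within {0..})"
    if "c < t" "t \<notin> N" for t
  proof -
    note [derivative_intros] = u_deriv[of t] v_deriv[of t]
    show ?thesis
      unfolding rotating_def using that assms
      by (auto intro!: derivative_eq_intros simp: algebra_simps power2_eq_square)
  qed
  have bound: "\<bar>?d t\<bar> \<le> ?r" if "c < t" "t < d" for t
  proof -
    have "\<bar>?d t\<bar> = 2 * (\<delta> t * (\<bar>v t\<bar> * \<bar>cos (lam * (t - s))\<bar>))"
      using damping_nonneg[of t] that assms by (simp add: abs_mult)
    also have "\<dots> \<le> 2 * (\<eta> * (sqrt (energy s) * 1))"
    proof -
      have "\<bar>v t\<bar> * \<bar>cos (lam * (t - s))\<bar> \<le> sqrt (energy s) * 1"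
        using abs_velocity_le[of s t] that assms by (intro mult_mono) (auto simp: energy_nonneg)
      moreover have "0 \<le> \<delta> t" "\<delta> t \<le> \<eta>"
        using damping_nonneg[of t] weak[of t] that assms by auto
      ultimately show ?thesis
        by (intro mult_left_mono[OF mult_mono]) auto
    qed
    finally show ?thesis by simp
  qed
  \<comment> \<open>\<open>nonincreasing\<close> is one-sided, so the bound \<open>?r\<close> on the
    speed is used once for \<open>rotating s\<close> and once for its negative.\<close>
  have "rotating s d - ?r * d \<le> rotating s c - ?r * c"
  proof (rule nonincreasing[OF \<open>0 \<le> c\<close> \<open>c \<le> d\<close>, where d = "\<lambda>t. ?d t - ?r"])
    show "abs_continuous_on_interval c d (\<lambda>t. rotating s t - ?r * t)"
      by (intro ac_intros ac)
    show "((\<lambda>t. rotating s t - ?r * t) has_real_derivative ?d t - ?r) (at t within {0..})"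
      if "c < t" "t < d" "t \<notin> N" for t
      using deriv[OF that(1,3)] by (auto intro!: derivative_eq_intros)
    show "?d t - ?r \<le> 0" if "c < t" "t < d" for t
      using bound[OF that] by linarith
  qed
  moreover have "- rotating s d - ?r * d \<le> - rotating s c - ?r * c"
  proof (rule nonincreasing[OF \<open>0 \<le> c\<close> \<open>c \<le> d\<close>, where d = "\<lambda>t. - ?d t - ?r"])
    show "abs_continuous_on_interval c d (\<lambda>t. - rotating s t - ?r * t)"
      by (intro ac_intros ac)
    show "((\<lambda>t. - rotating s t - ?r * t) has_real_derivative - ?d t - ?r) (at t within {0..})"
      if "c < t" "t < d" "t \<notin> N" for t
      using deriv[OF that(1,3)] by (auto intro!: derivative_eq_intros)
    show "- ?d t - ?r \<le> 0" if "c < t" "t < d" for t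
      using bound[OF that] by linarith
  qed
  ultimately show ?thesis by (simp add: algebra_simps abs_le_iff)
qed

text \<open>Two widths, because a continuous damping cannot drop at once from \<open>M\<close> to
  \<open>\<eta>\<close>: between \<open>\<epsilon>'\<close> and \<open>\<epsilon>\<close> it is only
  known to be nonnegative. The first burst makes \<open>v\<close> small, the free middle part turns
  this into a small \<open>lam * u\<close>, and the last burst makes \<open>v\<close> small again.
  The factor is \<open>10 = 9 + 1\<close>, from
  \<open>\<bar>lam * u\<bar> \<le> 3 * \<sigma> * r\<close> and
  \<open>v^2 \<le> \<sigma>^2 * e\<close> at the end.\<close>

lemma energy_quarter_period:
  assumes "0 \<le> s" and t0: "t\<^sub>0 = pi / (2 * lam)"
    and \<epsilon>: "0 < \<epsilon>'" "\<epsilon>' \<le> \<epsilon>" "2 * \<epsilon> \<le> t\<^sub>0" and "M > 0" "\<eta> \<ge> 0" "\<sigma> > 0"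
    and start: "\<And>t. \<lbrakk>s < t; t < s + \<epsilon>'\<rbrakk> \<Longrightarrow> M \<le> \<delta> t"
    and middle: "\<And>t. \<lbrakk>s + \<epsilon> < t; t < s + t\<^sub>0 - \<epsilon>\<rbrakk> \<Longrightarrow> \<delta> t \<le> \<eta>"
    and final: "\<And>t. \<lbrakk>s + t\<^sub>0 - \<epsilon>' < t; t < s + t\<^sub>0\<rbrakk> \<Longrightarrow> M \<le> \<delta> t"
    and small: "exp (- 4 * M * \<epsilon>') \<le> \<sigma>\<^sup>2 / 3" "lam / (4 * M) \<le> \<sigma>\<^sup>2 / 3" "lam * \<epsilon> \<le> \<sigma>\<^sup>2 / 3"
      "4 * lam * \<epsilon> \<le> \<sigma>" "2 * \<eta> * t\<^sub>0 \<le> \<sigma>"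
  shows "energy (s + t\<^sub>0) \<le> 10 * \<sigma>\<^sup>2 * energy s"
proof -
  define e r T where "e = energy s" and "r = sqrt e" and "T = s + t\<^sub>0"
  have "e \<ge> 0" by (simp add: e_def energy_nonneg)
  then have "r \<ge> 0" "r\<^sup>2 = e" by (simp_all add: r_def)
  \<comment> \<open>Two thirds of the budget \<open>\<sigma>^2 * e\<close> go to the burst; the last
    third is for the growth between \<open>\<epsilon>'\<close> and
    \<open>\<epsilon>\<close>.\<close>
  have damped: "exp (- 4 * M * \<epsilon>') * e + lam * e / (4 * M) \<le> 2 * \<sigma>\<^sup>2 / 3 * e"
    using mult_right_mono[OF small(1) \<open>e \<ge> 0\<close>] mult_right_mono[OF small(2) \<open>e \<ge> 0\<close>]
    by simp
  have "(v (s + \<epsilon>'))\<^sup>2 \<le> 2 * \<sigma>\<^sup>2 / 3 * e"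
    using velocity_squared_damping[of s "s + \<epsilon>'" e M] damped assms by (simp add: e_def)
  moreover have "(v (s + \<epsilon>))\<^sup>2 \<le> (v (s + \<epsilon>'))\<^sup>2 + lam * e * (\<epsilon> - \<epsilon>')"
    using velocity_squared_growth[of "s + \<epsilon>'" "s + \<epsilon>" e] energy_antimono[of s "s + \<epsilon>'"] assms
    by (simp add: e_def)
  moreover have "lam * e * (\<epsilon> - \<epsilon>') \<le> lam * e * \<epsilon>"
    using lam_pos \<open>e \<ge> 0\<close> \<epsilon> by (intro mult_left_mono) auto
  moreover have "lam * e * \<epsilon> \<le> \<sigma>\<^sup>2 / 3 * e"
    using mult_right_mono[OF small(3) \<open>e \<ge> 0\<close>] by (simp add: algebra_simps)
  ultimately have "(v (s + \<epsilon>))\<^sup>2 \<le> \<sigma>\<^sup>2 * e"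
    by (simp add: algebra_simps)
  then have "(v (s + \<epsilon>))\<^sup>2 \<le> (\<sigma> * r)\<^sup>2"
    by (simp add: power_mult_distrib \<open>r\<^sup>2 = e\<close>)
  then have v1: "\<bar>v (s + \<epsilon>)\<bar> \<le> \<sigma> * r"
    using \<open>\<sigma> > 0\<close> \<open>r \<ge> 0\<close> by (simp add: abs_le_square_iff[symmetric])
  have v2: "(v T)\<^sup>2 \<le> \<sigma>\<^sup>2 * e"
  proof -
    have "(v T)\<^sup>2 \<le> 2 * \<sigma>\<^sup>2 / 3 * e"
      using velocity_squared_damping[of "T - \<epsilon>'" T e M] damped
        energy_antimono[of s "T - \<epsilon>'"] assms by (simp add: e_def T_def)
    also have "\<dots> \<le> \<sigma>\<^sup>2 * e" using \<open>e \<ge> 0\<close> by (intro mult_right_mono) auto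
    finally show ?thesis .
  qed
  define x where "x = lam * \<epsilon>"
  have "x \<ge> 0" using lam_pos \<epsilon> by (simp add: x_def)
  have p1: "\<bar>rotating s (s + \<epsilon>)\<bar> \<le> r * x + \<sigma> * r"
  proof -
    have "\<bar>rotating s (s + \<epsilon>)\<bar> \<le> \<bar>lam * u (s + \<epsilon>)\<bar> * \<bar>sin x\<bar> + \<bar>v (s + \<epsilon>)\<bar> * \<bar>cos x\<bar>"
      by (simp add: rotating_def x_def flip: abs_mult)
    also have "\<dots> \<le> r * x + \<bar>v (s + \<epsilon>)\<bar> * 1"
      using abs_position_le[of s "s + \<epsilon>"] assms(1) \<epsilon> lam_pos abs_sin_x_le_abs_x[of x] \<open>x \<ge> 0\<close> \<open>r \<ge> 0\<close>
      by (intro add_mono mult_mono) (auto simp: abs_mult r_def e_def)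
    finally show ?thesis using v1 by simp
  qed
  have p2: "\<bar>rotating s (T - \<epsilon>) - rotating s (s + \<epsilon>)\<bar> \<le> \<sigma> * r"
  proof -
    have "\<bar>rotating s (T - \<epsilon>) - rotating s (s + \<epsilon>)\<bar> \<le> 2 * \<eta> * r * (T - \<epsilon> - (s + \<epsilon>))"
      using rotating_drift[of s "s + \<epsilon>" "T - \<epsilon>" \<eta>] assms(1) \<epsilon> middle
      by (simp add: T_def r_def e_def)
    also have "\<dots> \<le> 2 * \<eta> * r * t\<^sub>0"
      using \<open>\<eta> \<ge> 0\<close> \<open>r \<ge> 0\<close> \<epsilon> by (intro mult_left_mono) (auto simp: T_def)
    also have "\<dots> \<le> \<sigma> * r"
      using mult_right_mono[OF small(5) \<open>r \<ge> 0\<close>] by (simp add: algebra_simps)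
    finally show ?thesis .
  qed
  have p3: "\<bar>lam * u (T - \<epsilon>) - rotating s (T - \<epsilon>)\<bar> \<le> r * x + r * x"
  proof -
    \<comment> \<open>The rotation falls short of a quarter turn by \<open>x\<close>, so
      \<open>rotating s\<close> is nearly \<open>lam * u\<close> there.\<close>
    have angle: "lam * (T - \<epsilon> - s) = pi / 2 - x"
      using lam_pos by (simp add: T_def t0 x_def algebra_simps)
    have "lam * u (T - \<epsilon>) - rotating s (T - \<epsilon>)
        = lam * u (T - \<epsilon>) * (1 - cos x) + - (v (T - \<epsilon>) * sin x)"
      unfolding rotating_def angle by (simp add: sin_diff cos_diff algebra_simps)
    also have "\<bar>\<dots>\<bar> \<le> \<bar>lam * u (T - \<epsilon>)\<bar> * \<bar>1 - cos x\<bar> + \<bar>v (T - \<epsilon>)\<bar> * \<bar>sin x\<bar>"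
      by (rule order_trans[OF abs_triangle_ineq]) (simp add: abs_mult)
    also have "\<dots> \<le> r * x + r * x"
      using abs_position_le[of s "T - \<epsilon>"] abs_velocity_le[of s "T - \<epsilon>"] assms(1) \<epsilon> lam_pos
        abs_sin_x_le_abs_x[of x] one_minus_cos_le[of x] \<open>x \<ge> 0\<close> \<open>r \<ge> 0\<close>
      by (intro add_mono mult_mono) (auto simp: abs_mult r_def e_def T_def)
    finally show ?thesis .
  qed
  have p4: "\<bar>lam * u T - lam * u (T - \<epsilon>)\<bar> \<le> r * x"
  proof -
    have "lam * \<bar>u T - u (T - \<epsilon>)\<bar> \<le> lam * (r * \<epsilon>)"
      using position_drift[of s "T - \<epsilon>" T] assms(1) \<epsilon> lam_pos
      by (intro mult_left_mono) (auto simp: T_def r_def e_def)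
    then show ?thesis
      using lam_pos by (simp add: x_def abs_mult mult.left_commute flip: right_diff_distrib)
  qed
  \<comment> \<open>The errors \<open>p1\<close> to \<open>p4\<close> add up to
    \<open>4 * r * x + 2 * \<sigma> * r\<close>, which explains the 4 in the assumption on
    \<open>lam * \<epsilon>\<close>.\<close>
  have "4 * (r * x) \<le> \<sigma> * r"
    using mult_right_mono[OF small(4) \<open>r \<ge> 0\<close>] by (simp add: x_def algebra_simps)
  then have "\<bar>lam * u T\<bar> \<le> 3 * (\<sigma> * r)"
    using p1 p2 p3 p4 by linarith
  then have "(lam * u T)\<^sup>2 \<le> (3 * (\<sigma> * r))\<^sup>2"
    using power_mono[of "\<bar>lam * u T\<bar>" "3 * (\<sigma> * r)" 2] by simp
  then have "lam\<^sup>2 * (u T)\<^sup>2 \<le> 9 * \<sigma>\<^sup>2 * e"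
    by (simp add: power_mult_distrib \<open>r\<^sup>2 = e\<close>)
  then show ?thesis
    using v2 by (simp add: energy_def[of "s + t\<^sub>0"] T_def e_def)
qed

end

section \<open>From solutions to the oscillator, and iteration over periods\<close>

text \<open>For continuous \<open>\<delta>\<close> the equation makes the derivative of
  \<open>v\<close> continuous, so \<open>v\<close> is Lipschitz on bounded intervals.\<close>

lemma is_solution_imp_weak_solution:
  assumes "is_solution lam \<delta> u v"
  shows "weak_solution lam \<delta> u v"
proof (cases "continuous_on {0..} \<delta>")
  case True
  then have sol: "classical_solution lam \<delta> u v"
    using assms by (simp add: is_solution_def)
  let ?w = "\<lambda>t. - (2 * \<delta> t * v t) - lam\<^sup>2 * u t"
  have u: "(u has_real_derivative v t) (at t within {0..})" if "t \<ge> 0" for t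
    using sol that by (simp add: classical_solution_def)
  have v: "(v has_real_derivative ?w t) (at t within {0..})" if "t \<ge> 0" for t
  proof -
    have "\<exists>w. (v has_real_derivative w) (at t within {0..}) \<and> w + 2 * \<delta> t * v t + lam\<^sup>2 * u t = 0"
      using sol that by (simp add: classical_solution_def)
    then obtain w where "(v has_real_derivative w) (at t within {0..})"
      "w + 2 * \<delta> t * v t + lam\<^sup>2 * u t = 0" by blast
    moreover from this(2) have "w = ?w t" by linarith
    ultimately show ?thesis by simp
  qed
  have cont: "continuous_on {0..} u" "continuous_on {0..} v"
    using u v by (auto intro!: DERIV_continuous_on)
  have "abs_continuous_on_interval a b v" if "0 \<le> a" for a b
  proof (rule abs_continuous_on_interval_bounded_derivative[where f' = ?w])
    show "(v has_real_derivative ?w t) (at t within {a..b})" if "t \<in> {a..b}" for t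
      by (rule has_field_derivative_subset[OF v]) (use that \<open>0 \<le> a\<close> in auto)
    have "continuous_on {0..} ?w"
      by (intro continuous_intros cont True)
    then show "continuous_on {a..b} ?w"
      by (rule continuous_on_subset) (use \<open>0 \<le> a\<close> in auto)
  qed
  moreover have "AE t in lebesgue_on {0..}.
        \<exists>w. (v has_real_derivative w) (at t within {0..}) \<and> w + 2 * \<delta> t * v t + lam\<^sup>2 * u t = 0"
    by (rule AE_I2) (use v in \<open>auto intro!: exI[of _ "?w _"]\<close>)
  ultimately show ?thesis
    using u cont by (simp add: weak_solution_def locally_abs_continuous_on_halfline_def)
qed (use assms in \<open>simp add: is_solution_def\<close>)

lemma weak_solution_imp_damped_oscillator:
  assumes "weak_solution lam \<delta> u v" and "lam > 0" and "\<And>t. t \<ge> 0 \<Longrightarrow> \<delta> t \<ge> 0"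
  obtains N where "damped_oscillator lam \<delta> u v N"
proof -
  have "AE t in lebesgue_on {0..}.
      \<exists>w. (v has_real_derivative w) (at t within {0..}) \<and> w + 2 * \<delta> t * v t + lam\<^sup>2 * u t = 0"
    using assms(1) by (simp add: weak_solution_def)
  then have "AE t in lebesgue. t \<in> {0..} \<longrightarrow>
      (\<exists>w. (v has_real_derivative w) (at t within {0..}) \<and> w + 2 * \<delta> t * v t + lam\<^sup>2 * u t = 0)"
    by (subst (asm) AE_restrict_space_iff) auto
  then obtain N where N: "N \<in> null_sets lebesgue" and eq: "\<And>t. \<lbrakk>t \<ge> 0; t \<notin> N\<rbrakk> \<Longrightarrow>
      \<exists>w. (v has_real_derivative w) (at t within {0..}) \<and> w + 2 * \<delta> t * v t + lam\<^sup>2 * u t = 0"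
    by (rule AE_E3) auto
  have "(v has_real_derivative - (2 * \<delta> t * v t) - lam\<^sup>2 * u t) (at t within {0..})"
    if t: "t \<ge> 0" "t \<notin> N" for t
  proof -
    obtain w where "(v has_real_derivative w) (at t within {0..})" "w + 2 * \<delta> t * v t + lam\<^sup>2 * u t = 0"
      using eq[OF t] by blast
    moreover from this(2) have "w = - (2 * \<delta> t * v t) - lam\<^sup>2 * u t" by linarith
    ultimately show ?thesis by simp
  qed
  then have "damped_oscillator lam \<delta> u v N"
    using assms N by unfold_locales (auto simp: weak_solution_def negligible_iff_null_sets)
  then show thesis by (rule that)
qed

lemma periodic_on_halfline_multiple:
  assumes "periodic_on_halfline p f" and "p \<ge> 0" and "t \<ge> 0"
  shows "f (real n * p + t) = f t"
proof (induction n)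
  case (Suc n)
  have "f (real n * p + t + p) = f (real n * p + t)"
    using assms by (simp add: periodic_on_halfline_def)
  then show ?case using Suc by (simp add: algebra_simps)
qed simp

lemma solutions_decay_if_concentrated:
  assumes "lam > 0" "R > 0" and t0: "t\<^sub>0 = pi / (2 * lam)"
    and nonneg: "\<And>t. t \<ge> 0 \<Longrightarrow> \<delta> t \<ge> 0" and periodic: "periodic_on_halfline t\<^sub>0 \<delta>"
    and \<epsilon>: "0 < \<epsilon>'" "\<epsilon>' \<le> \<epsilon>" "2 * \<epsilon> \<le> t\<^sub>0" and "M > 0" "\<eta> \<ge> 0" "\<sigma> > 0"
    and start: "\<And>t. \<lbrakk>0 < t; t < \<epsilon>'\<rbrakk> \<Longrightarrow> M \<le> \<delta> t"
    and middle: "\<And>t. \<lbrakk>\<epsilon> < t; t < t\<^sub>0 - \<epsilon>\<rbrakk> \<Longrightarrow> \<delta> t \<le> \<eta>"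
    and final: "\<And>t. \<lbrakk>t\<^sub>0 - \<epsilon>' < t; t < t\<^sub>0\<rbrakk> \<Longrightarrow> M \<le> \<delta> t"
    and small: "exp (- 4 * M * \<epsilon>') \<le> \<sigma>\<^sup>2 / 3" "lam / (4 * M) \<le> \<sigma>\<^sup>2 / 3" "lam * \<epsilon> \<le> \<sigma>\<^sup>2 / 3"
      "4 * lam * \<epsilon> \<le> \<sigma>" "2 * \<eta> * t\<^sub>0 \<le> \<sigma>"
    and \<sigma>: "10 * \<sigma>\<^sup>2 \<le> exp (- R * t\<^sub>0)"
  shows "solutions_decay lam R t\<^sub>0 \<delta>"
  unfolding solutions_decay_def
proof (intro allI impI)
  fix u v and t :: real
  assume "is_solution lam \<delta> u v" and "t \<ge> 0"
  then obtain N where "damped_oscillator lam \<delta> u v N"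
    using is_solution_imp_weak_solution weak_solution_imp_damped_oscillator assms(1) nonneg by metis
  then interpret damped_oscillator lam \<delta> u v N .
  have "t\<^sub>0 > 0" using \<open>lam > 0\<close> by (simp add: t0)
  have step: "energy (real n * t\<^sub>0 + t\<^sub>0) \<le> exp (- R * t\<^sub>0) * energy (real n * t\<^sub>0)" for n
  proof -
    let ?s = "real n * t\<^sub>0"
    have shift: "\<delta> x = \<delta> (x - ?s)" if "x \<ge> ?s" for x
      using periodic_on_halfline_multiple[OF periodic, of "x - ?s" n] that \<open>t\<^sub>0 > 0\<close> by simp
    have "energy (?s + t\<^sub>0) \<le> 10 * \<sigma>\<^sup>2 * energy ?s"
    proof (rule energy_quarter_period[OF _ t0 \<epsilon> \<open>M > 0\<close> \<open>\<eta> \<ge> 0\<close> \<open>\<sigma> > 0\<close> _ _ _ small])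
      show "0 \<le> ?s" using \<open>t\<^sub>0 > 0\<close> by simp
      show "M \<le> \<delta> x" if "?s < x" "x < ?s + \<epsilon>'" for x
        using that start[of "x - ?s"] shift[of x] by simp
      show "\<delta> x \<le> \<eta>" if "?s + \<epsilon> < x" "x < ?s + t\<^sub>0 - \<epsilon>" for x
        using that middle[of "x - ?s"] shift[of x] \<epsilon> by simp
      show "M \<le> \<delta> x" if "?s + t\<^sub>0 - \<epsilon>' < x" "x < ?s + t\<^sub>0" for x
        using that final[of "x - ?s"] shift[of x] \<epsilon> by simp
    qed
    also have "\<dots> \<le> exp (- R * t\<^sub>0) * energy ?s"
      using \<sigma> by (rule mult_right_mono) (rule energy_nonneg)
    finally show ?thesis .
  qed
  have iter: "energy (real n * t\<^sub>0) \<le> exp (- R * (real n * t\<^sub>0)) * energy 0" for n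
  proof (induction n)
    case (Suc n)
    have "energy (real (Suc n) * t\<^sub>0) \<le> exp (- R * t\<^sub>0) * energy (real n * t\<^sub>0)"
      using step[of n] by (simp add: algebra_simps)
    also have "\<dots> \<le> exp (- R * t\<^sub>0) * (exp (- R * (real n * t\<^sub>0)) * energy 0)"
      using Suc by (intro mult_left_mono) auto
    also have "\<dots> = exp (- R * (real (Suc n) * t\<^sub>0)) * energy 0"
      by (simp add: algebra_simps flip: exp_add)
    finally show ?case .
  qed simp
  \<comment> \<open>The number of complete periods: \<open>real n * t\<^sub>0\<close> is at least
    \<open>t - t\<^sub>0\<close> and at least 0, hence at least the positive part.\<close>
  define n where "n = nat \<lfloor>t / t\<^sub>0\<rfloor>"
  have "real n \<le> t / t\<^sub>0" "t / t\<^sub>0 < real n + 1"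
    using \<open>t \<ge> 0\<close> \<open>t\<^sub>0 > 0\<close> by (auto simp: n_def)
  then have n: "real n * t\<^sub>0 \<le> t" "t - t\<^sub>0 \<le> real n * t\<^sub>0"
    using \<open>t\<^sub>0 > 0\<close> by (auto simp: field_simps)
  have "energy t \<le> energy (real n * t\<^sub>0)"
    using n \<open>t\<^sub>0 > 0\<close> by (intro energy_antimono) auto
  also have "\<dots> \<le> exp (- R * (real n * t\<^sub>0)) * energy 0" by (rule iter)
  also have "\<dots> \<le> exp (- R * max (t - t\<^sub>0) 0) * energy 0"
    using n \<open>t\<^sub>0 > 0\<close> \<open>R > 0\<close> energy_nonneg by (intro mult_right_mono) auto
  finally show "\<bar>v t\<bar>\<^sup>2 + lam\<^sup>2 * \<bar>u t\<bar>\<^sup>2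
      \<le> (\<bar>v 0\<bar>\<^sup>2 + lam\<^sup>2 * \<bar>u 0\<bar>\<^sup>2) * exp (- R * max (t - t\<^sub>0) 0)"
    by (simp add: energy_def mult.commute)
qed

section \<open>Concentrated dampings\<close>

lemma strong_damping_exists:
  fixes lam \<epsilon> \<kappa> :: real
  assumes "lam > 0" "\<epsilon> > 0" "\<kappa> > 0"
  obtains M where "M > 0" "exp (- 4 * M * \<epsilon>) \<le> \<kappa>" "lam / (4 * M) \<le> \<kappa>"
proof -
  \<comment> \<open>Each entry solves one of the two inequalities; the second also gives
    \<open>M > 0\<close> when \<open>\<kappa> \<ge> 1\<close>.\<close>
  define M where "M = max (- ln \<kappa> / (4 * \<epsilon>)) (lam / (4 * \<kappa>))"
  have M: "- ln \<kappa> / (4 * \<epsilon>) \<le> M" "lam / (4 * \<kappa>) \<le> M" by (simp_all add: M_def)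
  have "0 < lam / (4 * \<kappa>)" using assms by simp
  then have "M > 0" using M(2) by linarith
  moreover have "- 4 * M * \<epsilon> \<le> ln \<kappa>"
    using M(1) assms by (simp add: field_simps)
  then have "exp (- 4 * M * \<epsilon>) \<le> \<kappa>"
    using assms by (metis exp_le_cancel_iff exp_ln)
  moreover have "lam / (4 * M) \<le> \<kappa>"
    using M(2) \<open>M > 0\<close> assms by (simp add: field_simps)
  ultimately show thesis by (rule that)
qed

text \<open>A class closed under differentiation that contains the powers of the cosine; it yields
  smoothness without a formula for higher derivatives.\<close>

inductive_set trig_algebra :: "real \<Rightarrow> (real \<Rightarrow> real) set" for \<omega> :: real where
  const: "(\<lambda>_. c) \<in> trig_algebra \<omega>"
| sin: "(\<lambda>t. sin (\<omega> * t)) \<in> trig_algebra \<omega>"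
| cos: "(\<lambda>t. cos (\<omega> * t)) \<in> trig_algebra \<omega>"
| add: "\<lbrakk>f \<in> trig_algebra \<omega>; g \<in> trig_algebra \<omega>\<rbrakk> \<Longrightarrow> (\<lambda>t. f t + g t) \<in> trig_algebra \<omega>"
| mult: "\<lbrakk>f \<in> trig_algebra \<omega>; g \<in> trig_algebra \<omega>\<rbrakk> \<Longrightarrow> (\<lambda>t. f t * g t) \<in> trig_algebra \<omega>"

lemma trig_algebra_power: "f \<in> trig_algebra \<omega> \<Longrightarrow> (\<lambda>t. f t ^ n) \<in> trig_algebra \<omega>"
  by (induction n) (auto intro: trig_algebra.intros)

lemma trig_algebra_derivative:
  assumes "f \<in> trig_algebra \<omega>"
  shows "\<exists>g\<in>trig_algebra \<omega>. \<forall>t. (f has_real_derivative g t) (at t)"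
  using assms
proof induction
  case (const c)
  show ?case
    by (rule bexI[of _ "\<lambda>_. 0"]) (auto intro: trig_algebra.intros)
next
  case sin
  show ?case
    by (rule bexI[of _ "\<lambda>t. \<omega> * cos (\<omega> * t)"])
      (auto intro!: derivative_eq_intros trig_algebra.intros)
next
  case cos
  show ?case
  proof (rule bexI[of _ "\<lambda>t. - \<omega> * sin (\<omega> * t)"])
    show "(\<lambda>t. - \<omega> * sin (\<omega> * t)) \<in> trig_algebra \<omega>"
      by (intro trig_algebra.intros)
  qed (auto intro!: derivative_eq_intros)
next
  case (add f g)
  then obtain f' g' where "f' \<in> trig_algebra \<omega>" "\<And>t. (f has_real_derivative f' t) (at t)"
    "g' \<in> trig_algebra \<omega>" "\<And>t. (g has_real_derivative g' t) (at t)" by blast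
  then show ?case
    by (intro bexI[of _ "\<lambda>t. f' t + g' t"]) (auto intro!: derivative_intros trig_algebra.intros)
next
  case (mult f g)
  then obtain f' g' where "f' \<in> trig_algebra \<omega>" "\<And>t. (f has_real_derivative f' t) (at t)"
    "g' \<in> trig_algebra \<omega>" "\<And>t. (g has_real_derivative g' t) (at t)" by blast
  with mult.hyps show ?case
    by (intro bexI[of _ "\<lambda>t. f' t * g t + g' t * f t"])
      (auto intro!: DERIV_mult trig_algebra.add trig_algebra.mult)
qed

lemma trig_algebra_smooth:
  assumes "f \<in> trig_algebra \<omega>"
  shows "smooth_on_halfline f"
proof -
  have "\<exists>deriv. \<forall>f\<in>trig_algebra \<omega>. deriv f \<in> trig_algebra \<omega> \<and>
      (\<forall>t. (f has_real_derivative deriv f t) (at t))"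
    using trig_algebra_derivative by (intro bchoice) blast
  then obtain deriv where deriv: "\<And>f. f \<in> trig_algebra \<omega> \<Longrightarrow> deriv f \<in> trig_algebra \<omega>"
    "\<And>f t. f \<in> trig_algebra \<omega> \<Longrightarrow> (f has_real_derivative deriv f t) (at t)"
    by blast
  have "(deriv ^^ n) f \<in> trig_algebra \<omega>" for n
    by (induction n) (use assms deriv in auto)
  then have "((deriv ^^ n) f has_real_derivative (deriv ^^ Suc n) f t) (at t within {0..})" for n t
    using deriv(2) by (simp add: has_field_derivative_at_within)
  then show ?thesis
    unfolding smooth_on_halfline_def by (intro exI[of _ "\<lambda>n. (deriv ^^ n) f"]) auto
qed

text \<open>The cells on which \<open>\<lfloor>c * t\<rfloor>\<close> is constant are intervals, and
  a bounded set meets finitely many of them.\<close>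

lemma piecewise_constant_floor:
  assumes "c > 0" and floor: "\<And>s t. \<lfloor>c * s\<rfloor> = \<lfloor>c * t\<rfloor> \<Longrightarrow> f s = f t"
  shows "piecewise_constant_on_halfline f"
  unfolding piecewise_constant_on_halfline_def
proof (intro allI impI, elim conjE)
  fix J :: "real set" assume J: "is_interval J" "bounded J" "J \<subseteq> {0..}"
  obtain B where B: "\<And>t. t \<in> J \<Longrightarrow> \<bar>t\<bar> \<le> B"
    using J(2) unfolding bounded_iff by auto
  define piece where "piece k = J \<inter> {t. \<lfloor>c * t\<rfloor> = k}" for k
  show "\<exists>P. finite P \<and> \<Union>P = J \<and> (\<forall>I\<in>P. is_interval I \<and> f constant_on I)"
  proof (intro exI[of _ "piece ` {0..\<lfloor>c * B\<rfloor>}"] conjI ballI)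
    have "\<lfloor>c * t\<rfloor> \<in> {0..\<lfloor>c * B\<rfloor>}" if "t \<in> J" for t
      using B[OF that] J(3) that \<open>c > 0\<close> by (auto intro!: floor_mono mult_left_mono)
    then show "\<Union> (piece ` {0..\<lfloor>c * B\<rfloor>}) = J"
      by (auto simp: piece_def)
    fix I assume "I \<in> piece ` {0..\<lfloor>c * B\<rfloor>}"
    then obtain k where I: "I = piece k" by blast
    have "is_interval {t. \<lfloor>c * t\<rfloor> = k}"
      unfolding is_interval_1
    proof (intro ballI allI impI, elim conjE)
      fix a b x assume "a \<in> {t. \<lfloor>c * t\<rfloor> = k}" "b \<in> {t. \<lfloor>c * t\<rfloor> = k}" "a \<le> x" "x \<le> b"
      then show "x \<in> {t. \<lfloor>c * t\<rfloor> = k}"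
        using floor_mono[of "c * a" "c * x"] floor_mono[of "c * x" "c * b"] \<open>c > 0\<close> by simp
    qed
    then show "is_interval I"
      unfolding I piece_def using J(1) by (rule is_interval_Int[rotated])
    show "f constant_on I"
      unfolding constant_on_def
    proof (cases "I = {}")
      case False
      then obtain s where "s \<in> I" by blast
      then show "\<exists>y. \<forall>x\<in>I. f x = y"
        using floor by (auto simp: I piece_def)
    qed simp
  qed simp
qed

section \<open>The smooth and the piecewise constant damping\<close>

context
  fixes lam R t\<^sub>0 \<sigma> \<epsilon>\<^sub>0 :: real
  assumes lam: "lam > 0" and R: "R > 0" and t0: "t\<^sub>0 = pi / (2 * lam)"
    and \<sigma>: "\<sigma> > 0" "10 * \<sigma>\<^sup>2 \<le> exp (- R * t\<^sub>0)"
    and \<epsilon>\<^sub>0: "\<epsilon>\<^sub>0 > 0" "2 * \<epsilon>\<^sub>0 \<le> t\<^sub>0" "lam * \<epsilon>\<^sub>0 \<le> \<sigma>\<^sup>2 / 3" "4 * lam * \<epsilon>\<^sub>0 \<le> \<sigma>"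
begin

text \<open>Since \<open>2 * lam * t\<^sub>0 = pi\<close>, the square of
  \<open>cos (2 * lam * t)\<close> has period \<open>t\<^sub>0\<close> and peaks at its multiples;
  high powers sharpen the peaks.\<close>

lemma smooth_damping_exists:
  "\<exists>\<delta>. (\<forall>t\<ge>0. \<delta> t \<ge> 0) \<and> periodic_on_halfline t\<^sub>0 \<delta> \<and> solutions_decay lam R t\<^sub>0 \<delta> \<and>
       smooth_on_halfline \<delta>"
proof -
  have t0_pos: "t\<^sub>0 > 0" using lam by (simp add: t0)
  \<comment> \<open>The phase \<open>2 * lam * t\<close> equals \<open>x\<close> at
    \<open>\<epsilon>\<^sub>0 / 2\<close> and \<open>2 * x\<close> at
    \<open>\<epsilon>\<^sub>0\<close>, the two widths used below.\<close>
  define x where "x = lam * \<epsilon>\<^sub>0"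
  have "x > 0" using lam \<epsilon>\<^sub>0 by (simp add: x_def)
  have "lam * (2 * \<epsilon>\<^sub>0) \<le> lam * t\<^sub>0" using lam \<epsilon>\<^sub>0 by simp
  then have "x \<le> pi / 4" using lam by (simp add: x_def t0)
  have c: "0 \<le> cos (2 * x)" "cos (2 * x) < cos x" "0 < cos x"
    using \<open>x > 0\<close> \<open>x \<le> pi / 4\<close> pi_gt_zero
    by (auto intro!: cos_ge_zero cos_monotone_0_pi cos_gt_zero)
  obtain M where M: "M > 0" "exp (- 4 * M * (\<epsilon>\<^sub>0 / 2)) \<le> \<sigma>\<^sup>2 / 3" "lam / (4 * M) \<le> \<sigma>\<^sup>2 / 3"
    using strong_damping_exists[of lam "\<epsilon>\<^sub>0 / 2" "\<sigma>\<^sup>2 / 3"] lam \<epsilon>\<^sub>0 \<sigma> by auto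
  define \<eta> where "\<eta> = \<sigma> / (2 * t\<^sub>0)"
  have "\<eta> > 0" using \<sigma> t0_pos by (simp add: \<eta>_def)
  have "((cos (2 * x) / cos x)\<^sup>2) < 1"
    using c by (auto simp: power_less_one_iff abs_square_less_1)
  then obtain n where n: "((cos (2 * x) / cos x)\<^sup>2) ^ n < \<eta> / M"
    using real_arch_pow_inv[of "\<eta> / M" "(cos (2 * x) / cos x)\<^sup>2"] \<open>\<eta> > 0\<close> \<open>M > 0\<close> by auto
  \<comment> \<open>Normalised so that the damping equals \<open>M\<close> at
    \<open>\<epsilon>\<^sub>0 / 2\<close>; by the choice of \<open>n\<close> it is then below
    \<open>\<eta>\<close> at \<open>\<epsilon>\<^sub>0\<close>.\<close>
  define K where "K = M / ((cos x)\<^sup>2) ^ n"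
  have "K > 0" using c \<open>M > 0\<close> by (simp add: K_def)
  define \<delta> where "\<delta> t = K * ((cos (2 * lam * t))\<^sup>2) ^ n" for t
  have high: "M \<le> \<delta> t" if "cos x \<le> \<bar>cos (2 * lam * t)\<bar>" for t
  proof -
    have "M = K * ((cos x)\<^sup>2) ^ n" using c by (simp add: K_def)
    also have "\<dots> \<le> \<delta> t"
    proof -
      have "(cos x)\<^sup>2 \<le> (cos (2 * lam * t))\<^sup>2"
        using power_mono[OF that, of 2] c by simp
      then show ?thesis
        unfolding \<delta>_def using \<open>K > 0\<close> by (intro mult_left_mono[OF power_mono]) auto
    qed
    finally show ?thesis .
  qed
  have low: "\<delta> t \<le> \<eta>" if "\<bar>cos (2 * lam * t)\<bar> \<le> cos (2 * x)" for t
  proof -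
    have "\<delta> t \<le> K * ((cos (2 * x))\<^sup>2) ^ n"
    proof -
      have "(cos (2 * lam * t))\<^sup>2 \<le> (cos (2 * x))\<^sup>2"
        using power_mono[OF that, of 2] by simp
      then show ?thesis
        unfolding \<delta>_def using \<open>K > 0\<close> by (intro mult_left_mono[OF power_mono]) auto
    qed
    also have "\<dots> = M * ((cos (2 * x) / cos x)\<^sup>2) ^ n"
      by (simp add: K_def power_divide)
    also have "\<dots> \<le> \<eta>" using n \<open>M > 0\<close> by (simp add: field_simps)
    finally show ?thesis .
  qed
  have lt0: "2 * lam * t\<^sub>0 = pi" using lam by (simp add: t0)
  have nonneg: "\<delta> t \<ge> 0" for t using \<open>K > 0\<close> by (simp add: \<delta>_def)
  have periodic: "periodic_on_halfline t\<^sub>0 \<delta>"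
    unfolding periodic_on_halfline_def \<delta>_def
    using lt0 by (simp add: distrib_left)
  have reflect: "\<bar>cos (2 * lam * t)\<bar> = \<bar>cos (2 * lam * (t\<^sub>0 - t))\<bar>" for t
    using lt0 by (simp add: right_diff_distrib)
  have near: "cos x \<le> \<bar>cos (2 * lam * t)\<bar>" if "0 < t" "t < \<epsilon>\<^sub>0 / 2" for t
  proof -
    have "2 * lam * t \<le> x" using that lam by (simp add: x_def)
    moreover have "x \<le> pi" using \<open>x \<le> pi / 4\<close> pi_gt_zero by linarith
    ultimately have "cos x \<le> cos (2 * lam * t)"
      using that lam by (intro cos_monotone_0_pi_le) auto
    then show ?thesis by linarith
  qed
  have "solutions_decay lam R t\<^sub>0 \<delta>"
  proof (rule solutions_decay_if_concentrated[where \<epsilon> = \<epsilon>\<^sub>0 and \<epsilon>' = "\<epsilon>\<^sub>0 / 2" and \<eta> = \<eta> and \<sigma> = \<sigma>,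
        OF lam R t0 nonneg periodic])
    show "M \<le> \<delta> t" if "0 < t" "t < \<epsilon>\<^sub>0 / 2" for t
      using that by (intro high near)
    show "M \<le> \<delta> t" if "t\<^sub>0 - \<epsilon>\<^sub>0 / 2 < t" "t < t\<^sub>0" for t
      using near[of "t\<^sub>0 - t"] that reflect[of t] by (intro high) auto
    show "\<delta> t \<le> \<eta>" if t: "\<epsilon>\<^sub>0 < t" "t < t\<^sub>0 - \<epsilon>\<^sub>0" for t
    proof (rule low)
      \<comment> \<open>Only an upper bound for the cosine; at \<open>t\<^sub>0 - t\<close> the
        cosine changes sign, which gives the lower bound.\<close>
      have far: "cos (2 * lam * s) \<le> cos (2 * x)" if "\<epsilon>\<^sub>0 < s" "s < t\<^sub>0 - \<epsilon>\<^sub>0" for s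
      proof -
        have "2 * lam * s \<le> 2 * lam * t\<^sub>0" using that lam \<epsilon>\<^sub>0 by simp
        then show ?thesis
          using that lam \<open>x > 0\<close> lt0 by (intro cos_monotone_0_pi_le) (auto simp: x_def)
      qed
      have "cos (2 * lam * (t\<^sub>0 - t)) = - cos (2 * lam * t)"
        using lt0 by (simp add: right_diff_distrib)
      then show "\<bar>cos (2 * lam * t)\<bar> \<le> cos (2 * x)"
        using far[of t] far[of "t\<^sub>0 - t"] t by auto
    qed
    show "2 * \<eta> * t\<^sub>0 \<le> \<sigma>" using t0_pos by (simp add: \<eta>_def)
  qed (use \<epsilon>\<^sub>0 M \<sigma> \<open>\<eta> > 0\<close> in auto)
  moreover have "smooth_on_halfline \<delta>"
  proof (rule trig_algebra_smooth)
    show "\<delta> \<in> trig_algebra (2 * lam)"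
      unfolding \<delta>_def
      by (intro trig_algebra.mult trig_algebra.const trig_algebra_power trig_algebra.cos)
  qed
  ultimately show ?thesis using nonneg periodic by blast
qed

lemma piecewise_constant_damping_exists:
  "\<exists>\<delta>. (\<forall>t\<ge>0. \<delta> t \<ge> 0) \<and> periodic_on_halfline t\<^sub>0 \<delta> \<and> solutions_decay lam R t\<^sub>0 \<delta> \<and>
       piecewise_constant_on_halfline \<delta>"
proof -
  have t0_pos: "t\<^sub>0 > 0" using lam by (simp add: t0)
  \<comment> \<open>An integer number of cells makes the pattern fit the period, and rounding up
    keeps their length below \<open>\<epsilon>\<^sub>0\<close>.\<close>
  define n where "n = \<lceil>t\<^sub>0 / \<epsilon>\<^sub>0\<rceil>"
  define \<epsilon> where "\<epsilon> = t\<^sub>0 / real_of_int n"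
  have "t\<^sub>0 / \<epsilon>\<^sub>0 \<le> n" by (simp add: n_def)
  moreover have "2 \<le> t\<^sub>0 / \<epsilon>\<^sub>0" using \<epsilon>\<^sub>0 by (simp add: field_simps)
  ultimately have "n \<ge> 2" by linarith
  then have \<epsilon>: "0 < \<epsilon>" "\<epsilon> \<le> \<epsilon>\<^sub>0"
    using t0_pos \<open>t\<^sub>0 / \<epsilon>\<^sub>0 \<le> n\<close> \<epsilon>\<^sub>0 by (auto simp: \<epsilon>_def field_simps)
  have lam_\<epsilon>: "lam * \<epsilon> \<le> lam * \<epsilon>\<^sub>0" using lam \<epsilon> by simp
  obtain M where M: "M > 0" "exp (- 4 * M * \<epsilon>) \<le> \<sigma>\<^sup>2 / 3" "lam / (4 * M) \<le> \<sigma>\<^sup>2 / 3"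
    using strong_damping_exists[of lam \<epsilon> "\<sigma>\<^sup>2 / 3"] lam \<epsilon> \<sigma> by auto
  define c where "c = real_of_int n / t\<^sub>0"
  have "c > 0" using t0_pos \<open>n \<ge> 2\<close> by (simp add: c_def)
  have c: "c * t\<^sub>0 = n" "c * \<epsilon> = 1" using t0_pos \<open>n \<ge> 2\<close> by (auto simp: c_def \<epsilon>_def)
  define \<delta> where "\<delta> t = (if \<lfloor>c * t\<rfloor> mod n \<in> {0, n - 1} then M else 0)" for t
  have nonneg: "\<delta> t \<ge> 0" for t using M by (simp add: \<delta>_def)
  have "\<lfloor>c * (t + t\<^sub>0)\<rfloor> = \<lfloor>c * t\<rfloor> + n" for t
    using c by (simp add: distrib_left)
  then have periodic: "periodic_on_halfline t\<^sub>0 \<delta>"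
    by (simp add: periodic_on_halfline_def \<delta>_def)
  have "solutions_decay lam R t\<^sub>0 \<delta>"
  \<comment> \<open>Jumps are allowed here: there is no transition zone, and the damping vanishes in
    the middle.\<close>
  proof (rule solutions_decay_if_concentrated[where \<epsilon> = \<epsilon> and \<epsilon>' = \<epsilon> and \<eta> = 0 and \<sigma> = \<sigma>,
        OF lam R t0 nonneg periodic])
    show "M \<le> \<delta> t" if "0 < t" "t < \<epsilon>" for t
    proof -
      have "0 < c * t" "c * t < c * \<epsilon>" using that \<open>c > 0\<close> by auto
      then have "\<lfloor>c * t\<rfloor> = 0" using c by (simp add: floor_eq_iff)
      then show ?thesis by (simp add: \<delta>_def)
    qed
    show "M \<le> \<delta> t" if "t\<^sub>0 - \<epsilon> < t" "t < t\<^sub>0" for t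
    proof -
      have "c * (t\<^sub>0 - \<epsilon>) < c * t" "c * t < c * t\<^sub>0" using that \<open>c > 0\<close> by auto
      then have "\<lfloor>c * t\<rfloor> = n - 1"
        using c by (simp add: floor_eq_iff right_diff_distrib)
      moreover have "(n - 1) mod n = n - 1"
        using \<open>n \<ge> 2\<close> by (intro mod_pos_pos_trivial) auto
      ultimately show ?thesis by (simp only: \<delta>_def) simp
    qed
    show "\<delta> t \<le> 0" if "\<epsilon> < t" "t < t\<^sub>0 - \<epsilon>" for t
    proof -
      have "c * \<epsilon> < c * t" "c * t < c * (t\<^sub>0 - \<epsilon>)" using that \<open>c > 0\<close> by auto
      then have "1 < c * t" "c * t < real_of_int (n - 1)" using c by (auto simp: right_diff_distrib)
      moreover define k where "k = \<lfloor>c * t\<rfloor>"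
      ultimately have "1 \<le> k" "k < n - 1" by (simp_all only: le_floor_iff floor_less_iff)
      then have "k mod n = k" "k \<notin> {0, n - 1}" by auto
      then show ?thesis by (simp add: \<delta>_def flip: k_def)
    qed
  qed (use \<epsilon> \<epsilon>\<^sub>0 M \<sigma> lam_\<epsilon> in auto)
  moreover have "piecewise_constant_on_halfline \<delta>"
    by (rule piecewise_constant_floor[OF \<open>c > 0\<close>]) (simp add: \<delta>_def)
  ultimately show ?thesis using nonneg periodic by blast
qed

end

theorem theorem2p1:
  fixes lam R t\<^sub>0 :: real
  assumes "lam > 0" and "R > 0" and "t\<^sub>0 = pi / (2 * lam)"
  shows "(\<exists>\<delta>. (\<forall>t\<ge>0. \<delta> t \<ge> 0) \<and> periodic_on_halfline t\<^sub>0 \<delta> \<and> solutions_decay lam R t\<^sub>0 \<delta>) \<and>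
         (\<exists>\<delta>. (\<forall>t\<ge>0. \<delta> t \<ge> 0) \<and> periodic_on_halfline t\<^sub>0 \<delta> \<and> solutions_decay lam R t\<^sub>0 \<delta> \<and>
              smooth_on_halfline \<delta>) \<and>
         (\<exists>\<delta>. (\<forall>t\<ge>0. \<delta> t \<ge> 0) \<and> periodic_on_halfline t\<^sub>0 \<delta> \<and> solutions_decay lam R t\<^sub>0 \<delta> \<and>
              piecewise_constant_on_halfline \<delta>)"
proof -
  define \<sigma> where "\<sigma> = sqrt (exp (- R * t\<^sub>0) / 10)"
  have \<sigma>: "\<sigma> > 0" "10 * \<sigma>\<^sup>2 \<le> exp (- R * t\<^sub>0)" by (simp_all add: \<sigma>_def)
  have "t\<^sub>0 > 0" using assms by simp
  \<comment> \<open>One entry for each smallness condition on the width: disjoint bursts, growth of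
    \<open>v^2\<close> after a burst, rotation error.\<close>
  define \<epsilon>\<^sub>0 where "\<epsilon>\<^sub>0 = min (t\<^sub>0 / 2) (min (\<sigma>\<^sup>2 / 3 / lam) (\<sigma> / (4 * lam)))"
  have "\<epsilon>\<^sub>0 > 0" using \<sigma> \<open>t\<^sub>0 > 0\<close> assms by (simp add: \<epsilon>\<^sub>0_def)
  moreover have "\<epsilon>\<^sub>0 \<le> t\<^sub>0 / 2" "\<epsilon>\<^sub>0 \<le> \<sigma>\<^sup>2 / 3 / lam" "\<epsilon>\<^sub>0 \<le> \<sigma> / (4 * lam)"
    by (simp_all add: \<epsilon>\<^sub>0_def)
  then have "2 * \<epsilon>\<^sub>0 \<le> t\<^sub>0" "lam * \<epsilon>\<^sub>0 \<le> \<sigma>\<^sup>2 / 3" "4 * lam * \<epsilon>\<^sub>0 \<le> \<sigma>"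
    using assms(1) by (simp_all add: field_simps)
  ultimately show ?thesis
    using smooth_damping_exists[OF assms \<sigma>] piecewise_constant_damping_exists[OF assms \<sigma>] by blast
qed

end
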